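(* Let $M$ be a manifold and let $S$ be a quasispray on $M$. Then there exists a connection $\mathcal H$ in $TTM$ compatible with $S$, i.e. a connection $\mathcal H$ on $M$ such that $S(v)=\bigl(\pi_*|_{\mathcal H_v}\bigr)^{-1}(v)$ for all $v\in TM$.
   Context: $M$ is a smooth, finite-dimensional, Hausdorff, paracompact, connected manifold; all objects are smooth. $\pi:TM\to M$ is the projection; $\pi_T:TTM\to TM$ is the usual tangent bundle projection and $\pi_*:TTM\to TM$ the tangent map of $\pi$. The vertical bundle is $\mathcal V=\ker\pi_*\subset TTM$. A (general, possibly nonlinear) connection on $M$ is a smooth subbundle $\mathcal H$ of $\pi_T:TTM\to TM$ with $TTM=\mathcal H\oplus\mathcal V$. A SODE on $M$ is a smooth section $S:TM\to TTM$ of both $\pi_T$ and $\pi_*$; locally $S:(x,y)\mapsto(x,y,y,\mathcal S(x,y))$. A quasispray is a SODE (defined and smooth on all of $TM$) that vanishes on the $0$-section of $TM$. *)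

theory Defs
  imports "HOL-Analysis.Analysis"
begin

section \<open>Smooth maps between open subsets of normed spaces\<close>

text \<open>For an open subset of a finite-dimensional space this is the usual notion of class
  \<open>C^k\<close>: all iterated directional derivatives up to order \<open>k\<close> exist and are continuous.\<close>

primrec C_k_on ::
  "nat \<Rightarrow> 'e::real_normed_vector set \<Rightarrow> ('e \<Rightarrow> 'f::real_normed_vector) \<Rightarrow> bool" where
  "C_k_on 0 S f \<longleftrightarrow> continuous_on S f"
| "C_k_on (Suc k) S f \<longleftrightarrow> (\<forall>x\<in>S. f differentiable (at x)) \<and>
     (\<forall>v. C_k_on k S (\<lambda>x. frechet_derivative f (at x) v))"

definition smooth_on ::
  "'e::real_normed_vector set \<Rightarrow> ('e \<Rightarrow> 'f::real_normed_vector) \<Rightarrow> bool" where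
  "smooth_on S f \<longleftrightarrow> (\<forall>k. C_k_on k S f)"

section \<open>Smooth manifolds\<close>

text \<open>A chart is a pair of its domain and its coordinate map; the values of the coordinate map
  outside the domain are irrelevant. A smooth structure is given by a (not necessarily
  maximal) atlas.\<close>

type_synonym ('a, 'e) chart = "'a set \<times> ('a \<Rightarrow> 'e)"

record ('a, 'e) mfd =
  mtop :: "'a topology"
  atlas :: "('a, 'e) chart set"

abbreviation points :: "('a, 'e) mfd \<Rightarrow> 'a set" where
  "points M \<equiv> topspace (mtop M)"

definition charts_at :: "('a, 'e) mfd \<Rightarrow> 'a \<Rightarrow> ('a, 'e) chart set" where
  "charts_at M p = {c \<in> atlas M. p \<in> fst c}"

definition chart_inv :: "('a, 'e) chart \<Rightarrow> 'e \<Rightarrow> 'a" where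
  "chart_inv c = inv_into (fst c) (snd c)"

definition is_chart :: "'a topology \<Rightarrow> ('a, 'e::real_normed_vector) chart \<Rightarrow> bool" where
  "is_chart X c \<longleftrightarrow> openin X (fst c) \<and> open (snd c ` fst c) \<and>
     homeomorphic_map (subtopology X (fst c)) (top_of_set (snd c ` fst c)) (snd c)"

definition smooth_atlas :: "'a topology \<Rightarrow> ('a, 'e::real_normed_vector) chart set \<Rightarrow> bool" where
  "smooth_atlas X A \<longleftrightarrow> (\<forall>c\<in>A. is_chart X c) \<and> (\<Union>c\<in>A. fst c) = topspace X \<and>
     (\<forall>c\<in>A. \<forall>d\<in>A. smooth_on (snd c ` (fst c \<inter> fst d)) (snd d \<circ> chart_inv c))"

definition paracompact_space :: "'a topology \<Rightarrow> bool" where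
  "paracompact_space X \<longleftrightarrow>
     (\<forall>\<U>. (\<forall>U\<in>\<U>. openin X U) \<and> \<Union>\<U> = topspace X \<longrightarrow>
        (\<exists>\<V>. (\<forall>V\<in>\<V>. openin X V) \<and> \<Union>\<V> = topspace X \<and> (\<forall>V\<in>\<V>. \<exists>U\<in>\<U>. V \<subseteq> U) \<and>
             locally_finite_in X \<V>))"

text \<open>Finite dimension of the model space is an explicit hypothesis instead of the type class
  \<open>euclidean_space\<close>, because that class excludes dimension zero.\<close>

definition smooth_manifold :: "('a, 'e::real_normed_vector) mfd \<Rightarrow> bool" where
  "smooth_manifold M \<longleftrightarrow>
     (\<exists>B::'e set. finite B \<and> span B = UNIV) \<and>
     Hausdorff_space (mtop M) \<and> paracompact_space (mtop M) \<and> connected_space (mtop M) \<and>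
     smooth_atlas (mtop M) (atlas M)"

text \<open>Smooth maps defined on an open subset \<open>W\<close> of \<open>M\<close>.\<close>

definition smooth_map_on ::
  "('a, 'e::real_normed_vector) mfd \<Rightarrow> 'a set \<Rightarrow> ('b, 'f::real_normed_vector) mfd \<Rightarrow>
   ('a \<Rightarrow> 'b) \<Rightarrow> bool" where
  "smooth_map_on M W N f \<longleftrightarrow> openin (mtop M) W \<and>
     continuous_map (subtopology (mtop M) W) (mtop N) f \<and>
     (\<forall>c\<in>atlas M. \<forall>d\<in>atlas N.
        smooth_on (snd c ` {p \<in> W \<inter> fst c. f p \<in> fst d}) (snd d \<circ> f \<circ> chart_inv c))"

section \<open>The tangent bundle\<close>

text \<open>A tangent vector at \<open>p\<close> is \<open>(p, \<xi>)\<close>, where \<open>\<xi>\<close> assigns to every chart around \<open>p\<close> the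
  components of the vector in that chart, subject to the usual transformation law. The
  components in other charts are set to \<open>0\<close>, so that equal vectors are equal as pairs and the
  vector space operations are pointwise.\<close>

type_synonym ('a, 'e) tvec = "'a \<times> (('a, 'e) chart \<Rightarrow> 'e)"

definition tangent_space :: "('a, 'e::real_normed_vector) mfd \<Rightarrow> 'a \<Rightarrow> ('a, 'e) tvec set" where
  "tangent_space M p = {(q, \<xi>). q = p \<and> (\<forall>c. c \<notin> charts_at M p \<longrightarrow> \<xi> c = 0) \<and>
     (\<forall>c\<in>charts_at M p. \<forall>d\<in>charts_at M p.
        \<xi> d = frechet_derivative (snd d \<circ> chart_inv c) (at (snd c p)) (\<xi> c))}"

definition tangent_vectors :: "('a, 'e::real_normed_vector) mfd \<Rightarrow> ('a, 'e) tvec set" where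
  "tangent_vectors M = (\<Union>p\<in>points M. tangent_space M p)"

definition tproj :: "('a, 'e) tvec \<Rightarrow> 'a" where
  "tproj = fst"

definition tzero :: "'a \<Rightarrow> ('a, 'e::real_normed_vector) tvec" where
  "tzero p = (p, \<lambda>_. 0)"

text \<open>Addition is meant only for two vectors with the same base point.\<close>

definition tadd ::
  "('a, 'e::real_normed_vector) tvec \<Rightarrow> ('a, 'e) tvec \<Rightarrow> ('a, 'e) tvec" where
  "tadd v w = (tproj v, \<lambda>c. snd v c + snd w c)"

definition tlincomb ::
  "'a \<Rightarrow> nat \<Rightarrow> (nat \<Rightarrow> real) \<Rightarrow> (nat \<Rightarrow> ('a, 'e::real_normed_vector) tvec) \<Rightarrow> ('a, 'e) tvec" where
  "tlincomb p k a v = (p, \<lambda>c. \<Sum>i<k. a i *\<^sub>R snd (v i) c)"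

definition tangent_chart ::
  "('a, 'e::real_normed_vector) mfd \<Rightarrow> ('a, 'e) chart \<Rightarrow> (('a, 'e) tvec, 'e \<times> 'e) chart" where
  "tangent_chart M c =
     ({v \<in> tangent_vectors M. tproj v \<in> fst c}, \<lambda>v. (snd c (tproj v), snd v c))"

definition tangent_bundle ::
  "('a, 'e::real_normed_vector) mfd \<Rightarrow> (('a, 'e) tvec, 'e \<times> 'e) mfd" where
  "tangent_bundle M = \<lparr>
     mtop = topology_generated_by
       {{v \<in> fst (tangent_chart M c). snd (tangent_chart M c) v \<in> O'} | c O'.
          c \<in> atlas M \<and> open O'},
     atlas = tangent_chart M ` atlas M \<rparr>"

text \<open>The tangent map of \<open>f : M \<rightarrow> N\<close>; by the chain rule the choice of the chart of \<open>M\<close> does not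
  matter when \<open>f\<close> is smooth.\<close>

definition tangent_map ::
  "('a, 'e::real_normed_vector) mfd \<Rightarrow> ('b, 'f::real_normed_vector) mfd \<Rightarrow> ('a \<Rightarrow> 'b) \<Rightarrow>
   ('a, 'e) tvec \<Rightarrow> ('b, 'f) tvec" where
  "tangent_map M N f v =
     (let p = tproj v; c = (SOME c. c \<in> charts_at M p)
      in (f p, \<lambda>d. if d \<in> charts_at N (f p)
                   then frechet_derivative (snd d \<circ> f \<circ> chart_inv c) (at (snd c p)) (snd v c)
                   else 0))"

section \<open>Connections\<close>

definition fibre :: "('a, 'e) tvec set \<Rightarrow> 'a \<Rightarrow> ('a, 'e) tvec set" where
  "fibre D p = {w \<in> D. tproj w = p}"

definition smooth_vector_field_on ::
  "('a, 'e::real_normed_vector) mfd \<Rightarrow> 'a set \<Rightarrow> ('a \<Rightarrow> ('a, 'e) tvec) \<Rightarrow> bool" where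
  "smooth_vector_field_on N W X \<longleftrightarrow>
     smooth_map_on N W (tangent_bundle N) X \<and> (\<forall>q\<in>W. tproj (X q) = q)"

text \<open>A smooth subbundle of \<open>TN \<rightarrow> N\<close>: locally there are finitely many smooth vector fields
  which form a basis of every fibre. In particular the fibres are linear subspaces.\<close>

definition smooth_subbundle ::
  "('a, 'e::real_normed_vector) mfd \<Rightarrow> ('a, 'e) tvec set \<Rightarrow> bool" where
  "smooth_subbundle N D \<longleftrightarrow> D \<subseteq> tangent_vectors N \<and>
     (\<forall>p\<in>points N. \<exists>W k X. p \<in> W \<and> (\<forall>i<k. smooth_vector_field_on N W (X i)) \<and>
        openin (mtop N) W \<and>
        (\<forall>q\<in>W. fibre D q = {tlincomb q k a (\<lambda>i. X i q) | a. True} \<and>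
           (\<forall>a. tlincomb q k a (\<lambda>i. X i q) = tzero q \<longrightarrow> (\<forall>i<k. a i = 0))))"

text \<open>The tangent map \<open>TTM \<rightarrow> TM\<close> of the projection \<open>TM \<rightarrow> M\<close>. The other projection
  \<open>TTM \<rightarrow> TM\<close> is \<^const>\<open>tproj\<close>.\<close>

abbreviation tproj_star ::
  "('a, 'e::real_normed_vector) mfd \<Rightarrow> (('a, 'e) tvec, 'e \<times> 'e) tvec \<Rightarrow> ('a, 'e) tvec" where
  "tproj_star M \<equiv> tangent_map (tangent_bundle M) M tproj"

definition vertical_bundle ::
  "('a, 'e::real_normed_vector) mfd \<Rightarrow> (('a, 'e) tvec, 'e \<times> 'e) tvec set" where
  "vertical_bundle M = {w \<in> tangent_vectors (tangent_bundle M).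
     tproj_star M w = tzero (tproj (tproj w))}"

definition connection ::
  "('a, 'e::real_normed_vector) mfd \<Rightarrow> (('a, 'e) tvec, 'e \<times> 'e) tvec set \<Rightarrow> bool" where
  "connection M H \<longleftrightarrow> smooth_subbundle (tangent_bundle M) H \<and>
     (\<forall>w\<in>tangent_vectors (tangent_bundle M).
        \<exists>!(h, u). h \<in> fibre H (tproj w) \<and> u \<in> fibre (vertical_bundle M) (tproj w) \<and>
                  w = tadd h u)"

section \<open>Second-order differential equations\<close>

definition SODE ::
  "('a, 'e::real_normed_vector) mfd \<Rightarrow>
   (('a, 'e) tvec \<Rightarrow> (('a, 'e) tvec, 'e \<times> 'e) tvec) \<Rightarrow> bool" where
  "SODE M S \<longleftrightarrow>
     smooth_map_on (tangent_bundle M) (tangent_vectors M) (tangent_bundle (tangent_bundle M)) S \<and>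
     (\<forall>v\<in>tangent_vectors M. tproj (S v) = v \<and> tproj_star M (S v) = v)"

definition quasispray ::
  "('a, 'e::real_normed_vector) mfd \<Rightarrow>
   (('a, 'e) tvec \<Rightarrow> (('a, 'e) tvec, 'e \<times> 'e) tvec) \<Rightarrow> bool" where
  "quasispray M S \<longleftrightarrow> SODE M S \<and> (\<forall>p\<in>points M. S (tzero p) = tzero (tzero p))"

text \<open>For a connection \<open>H\<close>, the map \<open>tproj_star M\<close> is injective on \<open>fibre H v\<close> and has all
  of the tangent space at \<open>tproj v\<close> as its image there, so the inverse below is determined.\<close>

definition compatible ::
  "('a, 'e::real_normed_vector) mfd \<Rightarrow> (('a, 'e) tvec, 'e \<times> 'e) tvec set \<Rightarrow>
   (('a, 'e) tvec \<Rightarrow> (('a, 'e) tvec, 'e \<times> 'e) tvec) \<Rightarrow> bool" where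
  "compatible M H S \<longleftrightarrow> (\<forall>v\<in>tangent_vectors M. S v = inv_into (fibre H v) (tproj_star M) v)"

end

theory Submission
  imports Defs
begin

text \<open>In a chart write \<open>S(x, y) = (x, y, y, s(x, y))\<close> and put
  \<open>N(x, y) v = \<integral>\<^sub>0\<^sup>1 \<partial>\<^sub>y s(x, t y) v dt\<close>. Since \<open>s(x, 0) = 0\<close>, Hadamard's lemma gives
  \<open>N(x, y) y = s(x, y)\<close>. Under a change of charts \<open>\<phi>\<close> one has
  \<open>s'(\<phi> x, D\<phi> y) = D\<^sup>2\<phi>(y, y) + D\<phi> s(x, y)\<close>, and differentiating and integrating this yields
  \<open>N'(\<phi> x, D\<phi> y) D\<phi> v = D\<^sup>2\<phi>(y, v) + D\<phi> N(x, y) v\<close>, which is the transformation law of the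
  coefficients of a connection. Hence the subspaces \<open>{(v, N(x, y) v)}\<close> do not depend on the
  chart, and no partition of unity is needed.\<close>

section \<open>Smooth maps on finite-dimensional inner product spaces\<close>

text \<open>For a spray, where \<open>s\<close> is homogeneous of degree 2 in \<open>y\<close>, the
  classical choice is half of the fibre derivative of \<open>s\<close>. This choice has the right
  transformation law in general, but \<open>N(x, y) y = s(x, y)\<close> would then be Euler's
  identity, which fails without homogeneity. Averaging the fibre derivative over the segment from
  \<open>0\<close> to \<open>y\<close> keeps the transformation law, because coordinate changes of
  \<open>TM\<close> are linear on fibres and carry such segments to such segments; it replaces
  homogeneity by smoothness across the zero section together with \<open>s(x, 0) = 0\<close>. For
  homogeneous \<open>s\<close> the integrand is \<open>t\<close> times its value at
  \<open>t = 1\<close>, and the average is the classical half.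

  The analytic obstacle is the smoothness of \<open>N\<close>: \<open>C_k_on\<close> controls
  derivatives in fixed directions only, and the model space has just a finite spanning set and may
  have dimension zero. An explicit orthonormal basis \<open>B\<close> is therefore carried along,
  and derivatives in moving directions are expanded in it.\<close>

abbreviation fderiv ::
  "('e::real_normed_vector \<Rightarrow> 'f::real_normed_vector) \<Rightarrow> 'e \<Rightarrow> 'e \<Rightarrow> 'f" where
  "fderiv f x \<equiv> frechet_derivative f (at x)"

text \<open>An explicit set instead of \<open>Basis\<close>, so that dimension zero is allowed.
  Spanning is encoded as the expansion formula, the form in which it is always applied.\<close>

definition onb :: "'e::real_inner set \<Rightarrow> bool" where
  "onb B \<longleftrightarrow> finite B \<and> (\<forall>b\<in>B. \<forall>c\<in>B. b \<bullet> c = (if b = c then 1 else 0)) \<and>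
     (\<forall>x. (\<Sum>b\<in>B. (x \<bullet> b) *\<^sub>R b) = x)"

lemma onb_exists:
  fixes B :: "'e::real_inner set"
  assumes "finite B" "span B = UNIV"
  shows "\<exists>C::'e set. onb C"
proof -
  obtain C where C: "finite C" "span C = (UNIV::'e set)" "pairwise orthogonal C"
    using basis_orthogonal[OF assms(1)] assms(2) by metis
  \<comment> \<open>An orthogonal spanning set may contain \<open>0\<close>, which cannot be
    normalised.\<close>
  define E where "E = (\<lambda>c. c /\<^sub>R norm c) ` (C - {0})"
  have fin: "finite E" using C(1) by (simp add: E_def)
  have orth: "b \<bullet> c = (if b = c then 1 else 0)" if b: "b \<in> E" and c: "c \<in> E" for b c
  proof -
    obtain b' c' where b': "b' \<in> C" "b' \<noteq> 0" "b = b' /\<^sub>R norm b'"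
      and c': "c' \<in> C" "c' \<noteq> 0" "c = c' /\<^sub>R norm c'"
      using b c by (auto simp: E_def)
    show ?thesis
    proof (cases "b' = c'")
      case True
      then show ?thesis using b' c' by (simp add: dot_square_norm power2_eq_square)
    next
      case False
      then have o: "b' \<bullet> c' = 0"
        using C(3) b' c' by (auto simp: pairwise_def orthogonal_def)
      then have "b \<bullet> c = 0" by (simp add: b' c')
      moreover have "b \<noteq> c"
      proof
        assume "b = c"
        then have "b \<bullet> b = 0" using \<open>b \<bullet> c = 0\<close> by simp
        then show False using b' by simp
      qed
      ultimately show ?thesis by simp
    qed
  qed
  have "C \<subseteq> span E"
  proof
    fix c assume c: "c \<in> C"
    show "c \<in> span E"
    proof (cases "c = 0")
      case True then show ?thesis by (simp add: span_zero)
    next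
      case False
      then have "c /\<^sub>R norm c \<in> span E" using c by (auto simp: E_def intro!: span_base)
      then have "norm c *\<^sub>R (c /\<^sub>R norm c) \<in> span E" by (rule span_scale)
      then show ?thesis using False by simp
    qed
  qed
  then have spanE: "span E = UNIV"
    using C(2) by (metis span_mono span_span top.extremum_uniqueI)
  have exp: "(\<Sum>b\<in>E. (x \<bullet> b) *\<^sub>R b) = x" for x
  proof -
    have "x \<in> span E" using spanE by simp
    then obtain u where u: "x = (\<Sum>b\<in>E. u b *\<^sub>R b)"
      using span_finite[OF fin] by auto
    have "x \<bullet> b = u b" if "b \<in> E" for b
    proof -
      have "x \<bullet> b = (\<Sum>c\<in>E. u c * (c \<bullet> b))" by (simp add: u inner_sum_left)
      also have "\<dots> = (\<Sum>c\<in>E. if c = b then u c else 0)"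
        using that by (intro sum.cong) (auto simp: orth)
      also have "\<dots> = u b" using that fin by simp
      finally show ?thesis .
    qed
    then show ?thesis using u by (metis (mono_tags, lifting) sum.cong)
  qed
  show ?thesis using fin orth exp unfolding onb_def by blast
qed

lemma linear_onb:
  assumes "onb B" "linear f"
  shows "f x = (\<Sum>b\<in>B. (x \<bullet> b) *\<^sub>R f b)"
proof -
  have "f x = f (\<Sum>b\<in>B. (x \<bullet> b) *\<^sub>R b)" using assms(1) by (simp add: onb_def)
  then show ?thesis by (simp add: linear_sum[OF assms(2)] linear_cmul[OF assms(2)])
qed

lemma onb_Times:
  assumes "onb B" "onb C"
  shows "onb ((\<lambda>b. (b, 0)) ` B \<union> (\<lambda>c. (0, c)) ` C)"
proof -
  \<comment> \<open>A member of an orthonormal set has inner product 1 with itself. Without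
    \<open>0\<close> the two embedded bases are disjoint, since \<open>(b, 0) = (0, c)\<close> only
    at the origin.\<close>
  have 0: "0 \<notin> B" "0 \<notin> C" using assms unfolding onb_def by force+
  have disj: "(\<lambda>b. (b, 0)) ` B \<inter> (\<lambda>c. (0, c)) ` C = {}" using 0 by auto
  have fin: "finite B" "finite C" using assms by (auto simp: onb_def)
  have "(\<Sum>b\<in>(\<lambda>b. (b, 0)) ` B \<union> (\<lambda>c. (0, c)) ` C. (x \<bullet> b) *\<^sub>R b) = x" for x
  proof -
    obtain x1 x2 where x: "x = (x1, x2)" by (cases x)
    have "(\<Sum>b\<in>(\<lambda>b. (b, 0)) ` B \<union> (\<lambda>c. (0, c)) ` C. (x \<bullet> b) *\<^sub>R b) =
       (\<Sum>b\<in>B. (x1 \<bullet> b) *\<^sub>R (b, 0)) + (\<Sum>c\<in>C. (x2 \<bullet> c) *\<^sub>R (0, c))"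
      using fin disj by (subst sum.union_disjoint) (auto simp: sum.reindex inj_on_def x)
    also have "\<dots> = (\<Sum>b\<in>B. (x1 \<bullet> b) *\<^sub>R b, \<Sum>c\<in>C. (x2 \<bullet> c) *\<^sub>R c)"
      by (auto simp: prod_eq_iff fst_sum snd_sum)
    also have "\<dots> = x" using assms by (simp add: onb_def x)
    finally show ?thesis .
  qed
  moreover have "b \<bullet> c = (if b = c then 1 else 0)"
    if "b \<in> (\<lambda>b. (b, 0)) ` B \<union> (\<lambda>c. (0, c)) ` C" "c \<in> (\<lambda>b. (b, 0)) ` B \<union> (\<lambda>c. (0, c)) ` C" for b c
    using that 0 assms by (auto simp: onb_def split: if_splits) blast+
  ultimately show ?thesis using fin unfolding onb_def by blast
qed

section \<open>Closure properties of \<open>C^k\<close> and smooth maps\<close>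

lemma fderiv_has_derivative:
  "f differentiable (at x) \<Longrightarrow> (f has_derivative fderiv f x) (at x)"
  by (simp add: frechet_derivative_works)

lemma fderiv_eqI: "(f has_derivative f') (at x) \<Longrightarrow> fderiv f x = f'"
  using frechet_derivative_at by metis

text \<open>On an open set, derivatives see only values in the set. This is what permits arbitrary
  values of \<open>chart_inv\<close> and of coordinate expressions outside a chart.\<close>

lemma C_k_on_cong:
  assumes "open S" "C_k_on k S f" "\<And>x. x \<in> S \<Longrightarrow> f x = g x"
  shows "C_k_on k S g"
  using assms(2,3)
proof (induction k arbitrary: f g)
  case 0
  then show ?case using continuous_on_eq by fastforce
next
  case (Suc k)
  have d: "(g has_derivative fderiv f x) (at x)" if "x \<in> S" for x
  proof (rule has_derivative_transform_within_open[OF _ \<open>open S\<close> that])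
    show "(f has_derivative fderiv f x) (at x)"
      using Suc.prems(1) that by (auto intro: fderiv_has_derivative)
  qed (rule Suc.prems(2))
  then have e: "fderiv g x = fderiv f x" if "x \<in> S" for x
    using fderiv_eqI that by blast
  have "C_k_on k S (\<lambda>x. fderiv g x v)" for v
  proof (rule Suc.IH)
    show "C_k_on k S (\<lambda>x. fderiv f x v)" using Suc.prems(1) by simp
  qed (simp add: e)
  then show ?case using d by (auto intro: differentiableI)
qed

text \<open>Lets a derivative be given by a formula valid only on \<open>S\<close>; the inductions
  below then apply to the shape of the formula instead of to \<open>fderiv\<close>.\<close>

lemma C_k_on_SucI:
  assumes "open S" "\<And>x. x \<in> S \<Longrightarrow> (f has_derivative f' x) (at x)"
    "\<And>v. C_k_on k S (\<lambda>x. f' x v)"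
  shows "C_k_on (Suc k) S f"
  using assms fderiv_eqI[OF assms(2)]
  by (auto simp: differentiable_def intro!: C_k_on_cong[OF \<open>open S\<close> assms(3)])

lemma C_k_on_subset: "C_k_on k S f \<Longrightarrow> T \<subseteq> S \<Longrightarrow> C_k_on k T f"
  by (induction k arbitrary: f) (auto intro: continuous_on_subset)

lemma C_k_on_SucD: "C_k_on (Suc k) S f \<Longrightarrow> C_k_on k S f"
proof (induction k arbitrary: f)
  case 0
  then show ?case
    by (auto intro!: continuous_at_imp_continuous_on differentiable_imp_continuous_within)
next
  case (Suc k)
  then show ?case by (metis C_k_on.simps(2))
qed

lemma C_k_on_has_derivative:
  "C_k_on (Suc k) S f \<Longrightarrow> x \<in> S \<Longrightarrow> (f has_derivative fderiv f x) (at x)"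
  by (auto intro: fderiv_has_derivative)

lemma C_k_on_const: "open S \<Longrightarrow> C_k_on k S (\<lambda>x. c)"
  by (induction k arbitrary: c) simp_all

lemma C_k_on_bounded_linear:
  assumes "bounded_linear h" "open S" "C_k_on k S f"
  shows "C_k_on k S (\<lambda>x. h (f x))"
  using assms(3)
proof (induction k arbitrary: f)
  case 0
  then show ?case using bounded_linear.continuous_on[OF assms(1)] by simp
next
  case (Suc k)
  show ?case
  proof (rule C_k_on_SucI[OF \<open>open S\<close>])
    show "((\<lambda>x. h (f x)) has_derivative (\<lambda>v. h (fderiv f x v))) (at x)" if "x \<in> S" for x
      using bounded_linear.has_derivative[OF assms(1) C_k_on_has_derivative[OF Suc.prems that]] .
    show "C_k_on k S (\<lambda>x. h (fderiv f x v))" for v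
      using Suc by simp
  qed
qed

lemma C_k_on_add:
  assumes "open S" "C_k_on k S f" "C_k_on k S g"
  shows "C_k_on k S (\<lambda>x. f x + g x)"
  using assms(2,3)
proof (induction k arbitrary: f g)
  case 0
  then show ?case by (simp add: continuous_on_add)
next
  case (Suc k)
  show ?case
  proof (rule C_k_on_SucI[OF \<open>open S\<close>])
    show "((\<lambda>x. f x + g x) has_derivative (\<lambda>v. fderiv f x v + fderiv g x v)) (at x)" if "x \<in> S" for x
      by (intro has_derivative_add C_k_on_has_derivative[OF Suc.prems(1) that]
          C_k_on_has_derivative[OF Suc.prems(2) that])
    show "C_k_on k S (\<lambda>x. fderiv f x v + fderiv g x v)" for v
      using Suc by simp
  qed
qed

lemma C_k_on_sum:
  assumes "open S" "\<And>i. i \<in> I \<Longrightarrow> C_k_on k S (f i)"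
  shows "C_k_on k S (\<lambda>x. \<Sum>i\<in>I. f i x)"
  using assms(2)
  by (induction I rule: infinite_finite_induct) (auto simp: C_k_on_const C_k_on_add assms(1))

lemma C_k_on_bilinear:
  assumes "bounded_bilinear h" "open S" "C_k_on k S f" "C_k_on k S g"
  shows "C_k_on k S (\<lambda>x. h (f x) (g x))"
  using assms(3,4)
proof (induction k arbitrary: f g)
  case 0
  then show ?case using bounded_bilinear.continuous_on[OF assms(1)] by simp
next
  case (Suc k)
  show ?case
  proof (rule C_k_on_SucI[OF \<open>open S\<close>])
    show "((\<lambda>x. h (f x) (g x)) has_derivative (\<lambda>v. h (f x) (fderiv g x v) + h (fderiv f x v) (g x))) (at x)"
      if "x \<in> S" for x
      by (intro bounded_bilinear.FDERIV[OF assms(1)] C_k_on_has_derivative[OF Suc.prems(1) that]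
          C_k_on_has_derivative[OF Suc.prems(2) that])
    show "C_k_on k S (\<lambda>x. h (f x) (fderiv g x v) + h (fderiv f x v) (g x))" for v
      using Suc.prems C_k_on_SucD[OF Suc.prems(1)] C_k_on_SucD[OF Suc.prems(2)]
      by (intro C_k_on_add assms Suc.IH) auto
  qed
qed

lemma C_k_on_Pair:
  assumes "open S" "C_k_on k S f" "C_k_on k S g"
  shows "C_k_on k S (\<lambda>x. (f x, g x))"
  using assms(2,3)
proof (induction k arbitrary: f g)
  case 0
  then show ?case by (simp add: continuous_on_Pair)
next
  case (Suc k)
  show ?case
  proof (rule C_k_on_SucI[OF \<open>open S\<close>])
    show "((\<lambda>x. (f x, g x)) has_derivative (\<lambda>v. (fderiv f x v, fderiv g x v))) (at x)" if "x \<in> S" for x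
      by (intro has_derivative_Pair C_k_on_has_derivative[OF Suc.prems(1) that]
          C_k_on_has_derivative[OF Suc.prems(2) that])
    show "C_k_on k S (\<lambda>x. (fderiv f x v, fderiv g x v))" for v
      using Suc by simp
  qed
qed

text \<open>The chain rule yields \<open>fderiv g (f x) (fderiv f x v)\<close>, whose direction
  moves with \<open>x\<close>, so the induction hypothesis does not apply to it. Expanding the
  direction in \<open>B\<close> gives a sum of products with fixed directions, to which it
  does.\<close>

lemma C_k_on_compose:
  fixes B :: "'e::real_inner set" and f :: "'d::real_normed_vector \<Rightarrow> 'e"
    and g :: "'e \<Rightarrow> 'f::real_normed_vector"
  assumes "onb B" "open S" "open T" "C_k_on k S f" "C_k_on k T g" "\<And>x. x \<in> S \<Longrightarrow> f x \<in> T"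
  shows "C_k_on k S (\<lambda>x. g (f x))"
  using assms(4,5,6)
proof (induction k arbitrary: g)
  case 0
  then show ?case by (auto intro: continuous_on_compose2)
next
  case (Suc k)
  show ?case
  proof (rule C_k_on_SucI[OF \<open>open S\<close>])
    fix x assume x: "x \<in> S"
    have "((\<lambda>x. g (f x)) has_derivative (\<lambda>v. fderiv g (f x) (fderiv f x v))) (at x)"
      using x Suc.prems by (intro has_derivative_compose[of f _ x UNIV g] C_k_on_has_derivative[of k S f]
         C_k_on_has_derivative[of k T g]) auto
    moreover have "linear (fderiv g (f x))"
      using C_k_on_has_derivative[OF Suc.prems(2)] Suc.prems(3) x has_derivative_linear by blast
    ultimately show "((\<lambda>x. g (f x)) has_derivative
       (\<lambda>v. \<Sum>b\<in>B. (fderiv f x v \<bullet> b) *\<^sub>R fderiv g (f x) b)) (at x)"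
      by (simp only: linear_onb[OF assms(1), symmetric])
  next
    show "C_k_on k S (\<lambda>x. \<Sum>b\<in>B. (fderiv f x v \<bullet> b) *\<^sub>R fderiv g (f x) b)" for v
      using Suc.prems C_k_on_SucD[OF Suc.prems(1)]
      by (intro C_k_on_sum assms C_k_on_bilinear[OF bounded_bilinear_scaleR] Suc.IH
           C_k_on_bounded_linear[OF bounded_linear_inner_left]) auto
  qed
qed

lemma smooth_on_cong:
  "open S \<Longrightarrow> smooth_on S f \<Longrightarrow> (\<And>x. x \<in> S \<Longrightarrow> f x = g x) \<Longrightarrow> smooth_on S g"
  unfolding smooth_on_def using C_k_on_cong by blast

lemma smooth_on_subset: "smooth_on S f \<Longrightarrow> T \<subseteq> S \<Longrightarrow> smooth_on T f"
  unfolding smooth_on_def using C_k_on_subset by blast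

lemma smooth_on_has_derivative:
  "smooth_on S f \<Longrightarrow> x \<in> S \<Longrightarrow> (f has_derivative fderiv f x) (at x)"
  unfolding smooth_on_def using C_k_on_has_derivative by blast

lemma smooth_on_continuous: "smooth_on S f \<Longrightarrow> continuous_on S f"
  unfolding smooth_on_def using C_k_on.simps(1) by blast

lemma smooth_on_const: "open S \<Longrightarrow> smooth_on S (\<lambda>x. c)"
  by (simp add: smooth_on_def C_k_on_const)

lemma smooth_on_bounded_linear:
  "bounded_linear h \<Longrightarrow> open S \<Longrightarrow> smooth_on S f \<Longrightarrow> smooth_on S (\<lambda>x. h (f x))"
  by (simp add: smooth_on_def C_k_on_bounded_linear)

lemma smooth_on_ident: "open S \<Longrightarrow> smooth_on S (\<lambda>x. x)"
proof -
  assume S: "open S"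
  have "C_k_on k S (\<lambda>x. x)" for k
    by (cases k) (auto simp: C_k_on_const S)
  then show ?thesis by (simp add: smooth_on_def)
qed

lemma smooth_on_linear: "bounded_linear h \<Longrightarrow> open S \<Longrightarrow> smooth_on S h"
  using smooth_on_bounded_linear[OF _ _ smooth_on_ident] by fastforce

lemma smooth_on_sum:
  "open S \<Longrightarrow> (\<And>i. i \<in> I \<Longrightarrow> smooth_on S (f i)) \<Longrightarrow> smooth_on S (\<lambda>x. \<Sum>i\<in>I. f i x)"
  by (simp add: smooth_on_def C_k_on_sum)

lemma smooth_on_Pair:
  "open S \<Longrightarrow> smooth_on S f \<Longrightarrow> smooth_on S g \<Longrightarrow> smooth_on S (\<lambda>x. (f x, g x))"
  by (simp add: smooth_on_def C_k_on_Pair)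

lemma smooth_on_bilinear:
  "bounded_bilinear h \<Longrightarrow> open S \<Longrightarrow> smooth_on S f \<Longrightarrow> smooth_on S g \<Longrightarrow>
     smooth_on S (\<lambda>x. h (f x) (g x))"
  by (simp add: smooth_on_def C_k_on_bilinear)

lemma smooth_on_compose:
  fixes B :: "'e::real_inner set" and f :: "'d::real_normed_vector \<Rightarrow> 'e"
    and g :: "'e \<Rightarrow> 'f::real_normed_vector"
  shows "onb B \<Longrightarrow> open S \<Longrightarrow> open T \<Longrightarrow> smooth_on S f \<Longrightarrow> smooth_on T g \<Longrightarrow>
    (\<And>x. x \<in> S \<Longrightarrow> f x \<in> T) \<Longrightarrow> smooth_on S (\<lambda>x. g (f x))"
  unfolding smooth_on_def by (blast intro: C_k_on_compose)

lemma smooth_on_fderiv: "smooth_on S f \<Longrightarrow> smooth_on S (\<lambda>x. fderiv f x v)"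
  unfolding smooth_on_def using C_k_on.simps(2) by blast

text \<open>Moving base point and moving direction, again by expansion of the direction in
  \<open>B\<close>. The fibre part of a coordinate change of the tangent bundle has this
  form.\<close>

lemma smooth_on_fderiv_compose:
  fixes B :: "'e::real_inner set" and g h :: "'d::real_normed_vector \<Rightarrow> 'e"
    and f :: "'e \<Rightarrow> 'f::real_normed_vector"
  assumes "onb B" "open S" "open T" "smooth_on T f" "smooth_on S g" "smooth_on S h"
    "\<And>x. x \<in> S \<Longrightarrow> g x \<in> T"
  shows "smooth_on S (\<lambda>x. fderiv f (g x) (h x))"
proof (rule smooth_on_cong[OF \<open>open S\<close>])
  show "smooth_on S (\<lambda>x. \<Sum>b\<in>B. (h x \<bullet> b) *\<^sub>R fderiv f (g x) b)"
    by (intro smooth_on_sum smooth_on_bilinear[OF bounded_bilinear_scaleR]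
        smooth_on_bounded_linear[OF bounded_linear_inner_left] assms
        smooth_on_compose[OF assms(1,2,3,5) smooth_on_fderiv])
  fix x assume "x \<in> S"
  then have "linear (fderiv f (g x))"
    using smooth_on_has_derivative[OF assms(4)] assms(7) has_derivative_linear by blast
  then show "(\<Sum>b\<in>B. (h x \<bullet> b) *\<^sub>R fderiv f (g x) b) = fderiv f (g x) (h x)"
    by (rule linear_onb[OF assms(1), symmetric])
qed

section \<open>Symmetry of second derivatives\<close>

lemma has_vector_derivative_line:
  assumes "(f has_derivative f') (at (x + t *\<^sub>R u))"
  shows "((\<lambda>t. f (x + t *\<^sub>R u)) has_vector_derivative f' u) (at t)"
proof -
  have "((\<lambda>t. x + t *\<^sub>R u) has_derivative (\<lambda>h. h *\<^sub>R u)) (at t)"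
    by (auto intro!: derivative_eq_intros)
  from has_derivative_compose[OF this assms]
  show ?thesis
    using linear_cmul[OF has_derivative_linear[OF assms]] by (simp add: has_vector_derivative_def)
qed

text \<open>The mean value theorem is applied first along \<open>u\<close>, to the difference of two
  parallel edges, and then along \<open>v\<close>. The left side is symmetric in \<open>u\<close>
  and \<open>v\<close>, which is the source of the symmetry of second derivatives. Real values are
  essential for the mean value theorem.\<close>

lemma second_difference_mvt:
  fixes f :: "'e::real_normed_vector \<Rightarrow> real"
  assumes "C_k_on (Suc (Suc 0)) S f" "0 < s"
    "\<And>a b. 0 \<le> a \<Longrightarrow> a \<le> s \<Longrightarrow> 0 \<le> b \<Longrightarrow> b \<le> s \<Longrightarrow> x + a *\<^sub>R u + b *\<^sub>R v \<in> S"
  obtains a b where "0 < a" "a < s" "0 < b" "b < s"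
    "f (x + s *\<^sub>R u + s *\<^sub>R v) - f (x + s *\<^sub>R u) - f (x + s *\<^sub>R v) + f x =
       s * s * fderiv (\<lambda>z. fderiv f z u) (x + a *\<^sub>R u + b *\<^sub>R v) v"
proof -
  have d1: "((\<lambda>a. f (x + b *\<^sub>R v + a *\<^sub>R u)) has_real_derivative fderiv f (x + b *\<^sub>R v + a *\<^sub>R u) u) (at a)"
    if "0 \<le> a" "a \<le> s" "0 \<le> b" "b \<le> s" for a b
  proof -
    have "x + b *\<^sub>R v + a *\<^sub>R u \<in> S" using assms(3)[OF that] by (simp add: ac_simps)
    from has_vector_derivative_line[OF C_k_on_has_derivative[OF assms(1) this]]
    show ?thesis by (simp add: has_real_derivative_iff_has_vector_derivative)
  qed
  have d2: "((\<lambda>b. fderiv f (x + a *\<^sub>R u + b *\<^sub>R v) u) has_real_derivative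
      fderiv (\<lambda>z. fderiv f z u) (x + a *\<^sub>R u + b *\<^sub>R v) v) (at b)"
    if "0 \<le> a" "a \<le> s" "0 \<le> b" "b \<le> s" for a b
  proof -
    have "C_k_on (Suc 0) S (\<lambda>z. fderiv f z u)" using assms(1) C_k_on.simps(2) by blast
    from has_vector_derivative_line[OF C_k_on_has_derivative[OF this assms(3)[OF that]]]
    show ?thesis by (simp add: has_real_derivative_iff_has_vector_derivative)
  qed
  have "\<exists>z. 0 < z \<and> z < s \<and> (f (x + s *\<^sub>R v + s *\<^sub>R u) - f (x + s *\<^sub>R u)) -
      (f (x + s *\<^sub>R v + 0 *\<^sub>R u) - f (x + 0 *\<^sub>R u)) =
      (s - 0) * (fderiv f (x + s *\<^sub>R v + z *\<^sub>R u) u - fderiv f (x + z *\<^sub>R u) u)"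
    using d1[of _ s] d1[of _ 0] assms(2)
    by (intro MVT2[where f = "\<lambda>a. f (x + s *\<^sub>R v + a *\<^sub>R u) - f (x + a *\<^sub>R u)"] DERIV_diff) auto
  then obtain a where a: "0 < a" "a < s"
    "f (x + s *\<^sub>R v + s *\<^sub>R u) - f (x + s *\<^sub>R u) - (f (x + s *\<^sub>R v) - f x) =
      s * (fderiv f (x + s *\<^sub>R v + a *\<^sub>R u) u - fderiv f (x + a *\<^sub>R u) u)" by auto
  have "\<exists>z. 0 < z \<and> z < s \<and> fderiv f (x + a *\<^sub>R u + s *\<^sub>R v) u - fderiv f (x + a *\<^sub>R u + 0 *\<^sub>R v) u =
      (s - 0) * fderiv (\<lambda>z. fderiv f z u) (x + a *\<^sub>R u + z *\<^sub>R v) v"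
    using d2[of a] assms(2) a by (intro MVT2) auto
  then obtain b where b: "0 < b" "b < s"
    "fderiv f (x + a *\<^sub>R u + s *\<^sub>R v) u - fderiv f (x + a *\<^sub>R u) u =
      s * fderiv (\<lambda>z. fderiv f z u) (x + a *\<^sub>R u + b *\<^sub>R v) v" by auto
  have comm: "x + s *\<^sub>R v + c *\<^sub>R u = x + c *\<^sub>R u + s *\<^sub>R v" for c by simp
  show ?thesis
    using a b by (intro that[of a b]) (simp_all add: comm algebra_simps)
qed

text \<open>The same second difference expresses either mixed derivative at some point of a small
  parallelogram at \<open>x\<close>; continuity carries the equality to \<open>x\<close>.\<close>

lemma fderiv_symmetric_real:
  fixes f :: "'e::real_normed_vector \<Rightarrow> real"
  assumes "open S" "C_k_on (Suc (Suc 0)) S f" "x \<in> S"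
  shows "fderiv (\<lambda>z. fderiv f z u) x v = fderiv (\<lambda>z. fderiv f z v) x u"
proof (rule ccontr)
  let ?F = "\<lambda>z. fderiv (\<lambda>z. fderiv f z u) z v" and ?G = "\<lambda>z. fderiv (\<lambda>z. fderiv f z v) z u"
  assume ne: "?F x \<noteq> ?G x"
  \<comment> \<open>Half of the supposed gap: two errors smaller than \<open>e\<close> cannot bridge
    it.\<close>
  define e where "e = \<bar>?F x - ?G x\<bar> / 2"
  have e: "e > 0" using ne by (simp add: e_def)
  have "continuous_on S (\<lambda>z. fderiv (\<lambda>z. fderiv f z a) z b)" for a b
    using assms(2) unfolding C_k_on.simps by blast
  then have cont: "isCont ?F x" "isCont ?G x"
    using continuous_on_eq_continuous_at[OF assms(1)] assms(3) by blast+
  obtain d1 d2 d3 where d: "d1 > 0" "\<And>z. dist z x < d1 \<Longrightarrow> dist (?F z) (?F x) < e"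
     "d2 > 0" "\<And>z. dist z x < d2 \<Longrightarrow> dist (?G z) (?G x) < e"
     "d3 > 0" "ball x d3 \<subseteq> S"
    using cont e \<open>x \<in> S\<close> \<open>open S\<close> unfolding continuous_at open_contains_ball tendsto_iff eventually_at_le
    by (metis (no_types, lifting) cont continuous_at_eps_delta)
  define d where "d = Min {d1, d2, d3}"
  have d0: "d > 0" using d by (simp add: d_def)
  \<comment> \<open>Keeps the whole parallelogram within \<open>d / 2\<close> of \<open>x\<close>;
    the summand 1 avoids a zero denominator when \<open>u\<close> and \<open>v\<close>
    vanish.\<close>
  define s where "s = d / (2 * (norm u + norm v + 1))"
  have s: "s > 0" using d0 by (simp add: s_def add_nonneg_pos)
  have near: "dist (x + a *\<^sub>R u + b *\<^sub>R v) x < d" if "0 \<le> a" "a \<le> s" "0 \<le> b" "b \<le> s" for a b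
  proof -
    have "dist (x + a *\<^sub>R u + b *\<^sub>R v) x = norm (a *\<^sub>R u + b *\<^sub>R v)"
      by (simp add: dist_norm)
    also have "\<dots> \<le> a * norm u + b * norm v"
      using that norm_triangle_ineq[of "a *\<^sub>R u" "b *\<^sub>R v"] by simp
    also have "\<dots> \<le> s * norm u + s * norm v"
      using that by (intro add_mono mult_right_mono) auto
    also have "\<dots> \<le> s * (norm u + norm v + 1)" using s by (simp add: algebra_simps)
    also have "\<dots> = d / 2"
    proof -
      have "norm u + norm v + 1 > 0" by (simp add: add_nonneg_pos)
      then show ?thesis by (simp add: s_def field_simps)
    qed
    also have "\<dots> < d" using d0 by simp
    finally show ?thesis .
  qed
  then have inS: "x + a *\<^sub>R u + b *\<^sub>R v \<in> S" if "0 \<le> a" "a \<le> s" "0 \<le> b" "b \<le> s" for a b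
    using that d by (auto simp: d_def dist_commute subset_iff)
  then have inS': "x + a *\<^sub>R v + b *\<^sub>R u \<in> S" if "0 \<le> a" "a \<le> s" "0 \<le> b" "b \<le> s" for a b
    using that inS[of b a] by (simp add: ac_simps)
  obtain a b where ab: "0 < a" "a < s" "0 < b" "b < s"
    "f (x + s *\<^sub>R u + s *\<^sub>R v) - f (x + s *\<^sub>R u) - f (x + s *\<^sub>R v) + f x =
       s * s * ?F (x + a *\<^sub>R u + b *\<^sub>R v)"
    using second_difference_mvt[OF assms(2) s inS] by blast
  obtain a' b' where ab': "0 < a'" "a' < s" "0 < b'" "b' < s"
    "f (x + s *\<^sub>R v + s *\<^sub>R u) - f (x + s *\<^sub>R v) - f (x + s *\<^sub>R u) + f x =
       s * s * ?G (x + a' *\<^sub>R v + b' *\<^sub>R u)"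
    using second_difference_mvt[OF assms(2) s inS'] by blast
  have swap: "x + c *\<^sub>R v + c' *\<^sub>R u = x + c' *\<^sub>R u + c *\<^sub>R v" for c c' by simp
  have "s * s * ?F (x + a *\<^sub>R u + b *\<^sub>R v) = s * s * ?G (x + a' *\<^sub>R v + b' *\<^sub>R u)"
    using ab(5) ab'(5) unfolding swap[of s s] by linarith
  then have eq: "?F (x + a *\<^sub>R u + b *\<^sub>R v) = ?G (x + b' *\<^sub>R u + a' *\<^sub>R v)"
    using s by (simp add: ac_simps)
  have "dist (?F (x + a *\<^sub>R u + b *\<^sub>R v)) (?F x) < e"
    using near[of a b] ab by (intro d) (auto simp: d_def)
  moreover have "dist (?G (x + b' *\<^sub>R u + a' *\<^sub>R v)) (?G x) < e"
    using near[of b' a'] ab' by (intro d) (auto simp: d_def)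
  ultimately show False using eq unfolding e_def dist_real_def by argo
qed

text \<open>Reduction to the real case by pairing with every vector \<open>w\<close>.\<close>

lemma fderiv_symmetric:
  fixes f :: "'e::real_normed_vector \<Rightarrow> 'f::real_inner"
  assumes "open S" "C_k_on (Suc (Suc 0)) S f" "x \<in> S"
  shows "fderiv (\<lambda>z. fderiv f z u) x v = fderiv (\<lambda>z. fderiv f z v) x u"
proof -
  have inner: "fderiv (\<lambda>z. fderiv (\<lambda>z. f z \<bullet> w) z a) x b = fderiv (\<lambda>z. fderiv f z a) x b \<bullet> w" for a b w
  proof (rule fun_cong[OF fderiv_eqI])
    have "fderiv f z a \<bullet> w = fderiv (\<lambda>z. f z \<bullet> w) z a" if "z \<in> S" for z
    proof -
      have "((\<lambda>z. f z \<bullet> w) has_derivative (\<lambda>a. fderiv f z a \<bullet> w)) (at z)"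
        by (rule has_derivative_inner_left[OF C_k_on_has_derivative[OF assms(2) that]])
      then show ?thesis by (simp add: fderiv_eqI)
    qed
    moreover have "((\<lambda>z. fderiv f z a \<bullet> w) has_derivative (\<lambda>b. fderiv (\<lambda>z. fderiv f z a) x b \<bullet> w)) (at x)"
      using assms(2,3) by (intro has_derivative_inner_left C_k_on_has_derivative[of 0 S]) auto
    ultimately show "((\<lambda>z. fderiv (\<lambda>z. f z \<bullet> w) z a) has_derivative
        (\<lambda>b. fderiv (\<lambda>z. fderiv f z a) x b \<bullet> w)) (at x)"
      by (rule has_derivative_transform_within_open[OF _ assms(1,3), rotated])
  qed
  have "fderiv (\<lambda>z. fderiv f z u) x v \<bullet> w = fderiv (\<lambda>z. fderiv f z v) x u \<bullet> w" for w
    using fderiv_symmetric_real[OF assms(1) C_k_on_bounded_linear[OF bounded_linear_inner_left assms(1,2)] assms(3),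
        of w u v] by (simp only: inner)
  then show ?thesis by (metis vector_eq_rdot)
qed

section \<open>Hadamard's lemma with parameters\<close>

lemma continuous_on_scaled_integrand:
  fixes g :: "'e::real_normed_vector \<times> 'd::real_normed_vector \<Rightarrow> 'f::real_normed_vector"
  assumes "continuous_on (A \<times> UNIV) g"
  shows "continuous_on ((A \<times> UNIV) \<times> {0..1}) (\<lambda>(z, t). t ^ m *\<^sub>R g (fst z, t *\<^sub>R snd z))"
  unfolding split_beta
  by (intro continuous_intros continuous_on_compose2[OF assms]) auto

lemma scaled_integrand_integrable:
  fixes g :: "'e::real_normed_vector \<times> 'd::real_normed_vector \<Rightarrow> 'f::banach"
  assumes "continuous_on (A \<times> UNIV) g" "z \<in> A \<times> UNIV"
  shows "(\<lambda>t. t ^ m *\<^sub>R g (fst z, t *\<^sub>R snd z)) integrable_on {0..1}"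
  using assms(2)
  by (intro integrable_continuous_interval continuous_intros continuous_on_compose2[OF assms(1)]) auto

text \<open>Differentiation under the integral sign. A derivative in the second variable brings out
  one more factor \<open>t\<close>; the weight \<open>t ^ m\<close> makes this class of integrals
  closed under differentiation.\<close>

lemma has_derivative_scaled_integral:
  fixes g :: "'e::{real_inner,banach} \<times> 'd::{real_inner,banach} \<Rightarrow> 'f::banach"
  assumes "onb (B :: ('e \<times> 'd) set)" "open A" "C_k_on (Suc 0) (A \<times> UNIV) g" "z \<in> A \<times> UNIV"
  shows "((\<lambda>z. integral {0..1} (\<lambda>t. t ^ m *\<^sub>R g (fst z, t *\<^sub>R snd z))) has_derivative
     (\<lambda>w. integral {0..1} (\<lambda>t. t ^ m *\<^sub>R fderiv g (fst z, t *\<^sub>R snd z) (fst w, 0)) +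
          integral {0..1} (\<lambda>t. t ^ Suc m *\<^sub>R fderiv g (fst z, t *\<^sub>R snd z) (0, snd w)))) (at z)"
proof -
  \<comment> \<open>The Leibniz rule asks for a derivative that is jointly continuous as an
    operator, so it is assembled from rank-one operators over \<open>B\<close>. The vector
    \<open>(fst b, t *\<^sub>R snd b)\<close> appears because scaling the second component by
    \<open>t\<close> is self-adjoint.\<close>
  define fx where "fx z t = (\<Sum>b\<in>B. blinfun_scaleR_left (t ^ m *\<^sub>R fderiv g (fst z, t *\<^sub>R snd z) b) o\<^sub>L
     blinfun_inner_left (fst b, t *\<^sub>R snd b))" for z t
  have cg: "continuous_on (A \<times> UNIV) g"
    using C_k_on_SucD[OF assms(3)] by simp
  have cdg: "continuous_on (A \<times> UNIV) (\<lambda>x. fderiv g x v)" for v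
    using assms(3) unfolding C_k_on.simps by blast
  have lin: "linear (fderiv g (fst z, t *\<^sub>R snd z))" if "z \<in> A \<times> UNIV" for z t
    using C_k_on_has_derivative[OF assms(3)] that has_derivative_linear
    by (metis UNIV_I mem_Sigma_iff mem_Times_iff)
  have apply_fx: "fx z t w = t ^ m *\<^sub>R fderiv g (fst z, t *\<^sub>R snd z) (fst w, t *\<^sub>R snd w)"
    if "z \<in> A \<times> UNIV" for z t w
  proof -
    have "fx z t w = (\<Sum>b\<in>B. (w \<bullet> (fst b, t *\<^sub>R snd b)) *\<^sub>R t ^ m *\<^sub>R fderiv g (fst z, t *\<^sub>R snd z) b)"
      by (simp add: fx_def blinfun.sum_left)
    also have "\<dots> = t ^ m *\<^sub>R (\<Sum>b\<in>B. ((fst w, t *\<^sub>R snd w) \<bullet> b) *\<^sub>R fderiv g (fst z, t *\<^sub>R snd z) b)"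
      by (simp add: scaleR_sum_right inner_prod_def mult.commute)
    finally show ?thesis by (simp only: linear_onb[OF assms(1) lin[OF that], symmetric])
  qed
  \<comment> \<open>The Leibniz rule works on a convex set, whereas \<open>A\<close> is only open;
    hence the passage to a ball.\<close>
  obtain e where e: "e > 0" "ball z e \<subseteq> A \<times> UNIV"
    using assms(2,4) open_Times[OF assms(2) open_UNIV] open_contains_ball by metis
  have cfx: "continuous_on (ball z e \<times> {0..1}) (\<lambda>(z, t). fx z t)"
    unfolding fx_def split_beta using e(2)
    by (intro continuous_on_sum continuous_intros continuous_on_compose2[OF cdg]) auto
  have der: "((\<lambda>z. t ^ m *\<^sub>R g (fst z, t *\<^sub>R snd z)) has_derivative fx y t) (at y within ball z e)"
    if "y \<in> ball z e" for y t
  proof -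
    have y: "y \<in> A \<times> UNIV" using that e(2) by auto
    have "((\<lambda>z. g (fst z, t *\<^sub>R snd z)) has_derivative
       (\<lambda>w. fderiv g (fst y, t *\<^sub>R snd y) (fst w, t *\<^sub>R snd w))) (at y within ball z e)"
    proof (rule has_derivative_compose[of "\<lambda>z. (fst z, t *\<^sub>R snd z)"])
      show "(g has_derivative fderiv g (fst y, t *\<^sub>R snd y)) (at (fst y, t *\<^sub>R snd y))"
        using y by (intro C_k_on_has_derivative[OF assms(3)]) auto
    qed (auto intro!: derivative_eq_intros)
    then have "((\<lambda>z. t ^ m *\<^sub>R g (fst z, t *\<^sub>R snd z)) has_derivative
       (\<lambda>w. t ^ m *\<^sub>R fderiv g (fst y, t *\<^sub>R snd y) (fst w, t *\<^sub>R snd w))) (at y within ball z e)"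
      by (rule has_derivative_scaleR_right)
    then show ?thesis by (simp only: apply_fx[OF y, symmetric])
  qed
  have der_int: "((\<lambda>z. integral (cbox 0 1) (\<lambda>t. t ^ m *\<^sub>R g (fst z, t *\<^sub>R snd z))) has_derivative
      integral (cbox 0 1) (fx z)) (at z within ball z e)"
  proof (rule leibniz_rule)
    show "(\<lambda>t. t ^ m *\<^sub>R g (fst y, t *\<^sub>R snd y)) integrable_on cbox 0 1" if "y \<in> ball z e" for y
      using scaled_integrand_integrable[OF cg, of y m] subsetD[OF e(2) that] by simp
    show "continuous_on (ball z e \<times> cbox 0 1) (\<lambda>(z, t). fx z t)" using cfx by simp
    show "z \<in> ball z e" using e(1) by simp
  qed (rule der convex_ball; assumption?)+
  have at_eq: "at z within ball z e = at z" using e(1) by (intro at_within_open) auto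
  have apply_int: "integral (cbox 0 1) (fx z) w =
    integral {0..1} (\<lambda>t. t ^ m *\<^sub>R fderiv g (fst z, t *\<^sub>R snd z) (fst w, 0)) +
    integral {0..1} (\<lambda>t. t ^ Suc m *\<^sub>R fderiv g (fst z, t *\<^sub>R snd z) (0, snd w))" for w
  proof -
    have "continuous_on (cbox 0 1) (\<lambda>t. fx z t)"
      using e by (intro continuous_on_compose2[OF cfx, of _ "\<lambda>t. (z, t)", unfolded split_beta fst_conv snd_conv])
        (auto intro!: continuous_intros)
    then have "fx z integrable_on cbox 0 1" by (rule integrable_continuous)
    from blinfun_apply_integral[OF this]
    have "integral (cbox 0 1) (fx z) w = integral (cbox 0 1) (\<lambda>t. fx z t w)" .
    also have "\<dots> = integral {0..1} (\<lambda>t. t ^ m *\<^sub>R fderiv g (fst z, t *\<^sub>R snd z) (fst w, 0) +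
        t ^ Suc m *\<^sub>R fderiv g (fst z, t *\<^sub>R snd z) (0, snd w))"
    proof -
      have "fx z t w = t ^ m *\<^sub>R fderiv g (fst z, t *\<^sub>R snd z) (fst w, 0) +
        t ^ Suc m *\<^sub>R fderiv g (fst z, t *\<^sub>R snd z) (0, snd w)" for t
      proof -
        have "(fst w, t *\<^sub>R snd w) = (fst w, 0) + t *\<^sub>R (0, snd w)" by simp
        then show ?thesis
          by (simp only: apply_fx[OF assms(4)] linear_add[OF lin[OF assms(4)]]
              linear_cmul[OF lin[OF assms(4)]]) (simp add: scaleR_add_right mult.commute)
      qed
      then show ?thesis by simp
    qed
    also have "\<dots> = integral {0..1} (\<lambda>t. t ^ m *\<^sub>R fderiv g (fst z, t *\<^sub>R snd z) (fst w, 0)) +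
       integral {0..1} (\<lambda>t. t ^ Suc m *\<^sub>R fderiv g (fst z, t *\<^sub>R snd z) (0, snd w))"
      by (intro integral_add scaled_integrand_integrable[OF cdg assms(4)])
    finally show ?thesis .
  qed
  show ?thesis
    by (rule has_derivative_eq_rhs[OF der_int[unfolded at_eq, unfolded cbox_interval]
          ext[OF apply_int[unfolded cbox_interval]]])
qed

text \<open>The exponent \<open>m\<close> has to vary in the induction, since the derivative
  contains an integral with weight \<open>t ^ Suc m\<close>.\<close>

lemma C_k_on_scaled_integral:
  fixes g :: "'e::{real_inner,banach} \<times> 'd::{real_inner,banach} \<Rightarrow> 'f::banach"
  assumes "onb (B :: ('e \<times> 'd) set)" "open A" "C_k_on k (A \<times> UNIV) g"
  shows "C_k_on k (A \<times> UNIV) (\<lambda>z. integral {0..1} (\<lambda>t. t ^ m *\<^sub>R g (fst z, t *\<^sub>R snd z)))"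
  using assms(3)
proof (induction k arbitrary: g m)
  case 0
  then show ?case
    using integral_continuous_on_param[of "A \<times> UNIV" 0 1 "\<lambda>z t. t ^ m *\<^sub>R g (fst z, t *\<^sub>R snd z)"]
      continuous_on_scaled_integrand[of A g m] by simp
next
  case (Suc k)
  have op: "open (A \<times> (UNIV :: 'd set))" by (simp add: assms(2) open_Times)
  have "C_k_on (Suc 0) (A \<times> UNIV) g"
    using Suc.prems by (induction k) (blast intro: C_k_on_SucD)+
  show ?case
  proof (rule C_k_on_SucI[OF op has_derivative_scaled_integral[OF assms(1,2)]])
    show "C_k_on (Suc 0) (A \<times> UNIV) g" by fact
    show "C_k_on k (A \<times> UNIV) (\<lambda>z. integral {0..1} (\<lambda>t. t ^ m *\<^sub>R fderiv g (fst z, t *\<^sub>R snd z) (fst v, 0)) +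
          integral {0..1} (\<lambda>t. t ^ Suc m *\<^sub>R fderiv g (fst z, t *\<^sub>R snd z) (0, snd v)))" for v
      using Suc.prems by (intro C_k_on_add[OF op] Suc.IH) auto
  qed
qed

text \<open>The coefficient \<open>N(x, y) v\<close> of the overview; the direction
  \<open>(0, v)\<close> selects the partial derivative in the fibre variable.\<close>

definition hadamard ::
  "('e::real_normed_vector \<times> 'd::real_normed_vector \<Rightarrow> 'f::real_normed_vector) \<Rightarrow> 'e \<times> 'd \<Rightarrow> 'd \<Rightarrow> 'f"
  where "hadamard s z v = integral {0..1} (\<lambda>t. fderiv s (fst z, t *\<^sub>R snd z) (0, v))"

context
  fixes s :: "'e::{real_inner,banach} \<times> 'd::{real_inner,banach} \<Rightarrow> 'f::banach"
    and A :: "'e set"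
  assumes A: "open A" and s: "smooth_on (A \<times> UNIV) s"
begin

text \<open>The domain \<open>A \<times> UNIV\<close> contains full fibres, so the segment from the
  zero section to \<open>z\<close> never leaves it.\<close>

lemma hadamard_integrable:
  assumes "fst z \<in> A"
  shows "(\<lambda>t. fderiv s (fst z, t *\<^sub>R snd z) (0, v)) integrable_on {0..1}"
  using scaled_integrand_integrable[of A "\<lambda>x. fderiv s x (0, v)" z 0] assms
    smooth_on_continuous[OF smooth_on_fderiv[OF s]] by (simp add: mem_Times_iff)

lemma linear_fderiv_smooth: "fst z \<in> A \<Longrightarrow> linear (fderiv s z)"
  using smooth_on_has_derivative[OF s, of z] has_derivative_linear by (auto simp: mem_Times_iff)

lemma linear_hadamard:
  assumes "fst z \<in> A"
  shows "linear (hadamard s z)"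
proof (rule linearI)
  fix v w :: 'd and c :: real
  have lin: "linear (fderiv s (fst z, t *\<^sub>R snd z))" for t
    using linear_fderiv_smooth assms by simp
  have "fderiv s (fst z, t *\<^sub>R snd z) (0, v + w) =
    fderiv s (fst z, t *\<^sub>R snd z) (0, v) + fderiv s (fst z, t *\<^sub>R snd z) (0, w)" for t
    using linear_add[OF lin, of t "(0, v)" "(0, w)"] by simp
  then show "hadamard s z (v + w) = hadamard s z v + hadamard s z w"
    unfolding hadamard_def using hadamard_integrable[OF assms] by (simp add: integral_add)
  have "fderiv s (fst z, t *\<^sub>R snd z) (0, c *\<^sub>R v) = c *\<^sub>R fderiv s (fst z, t *\<^sub>R snd z) (0, v)" for t
    using linear_cmul[OF lin, of t c "(0, v)"] by simp
  then show "hadamard s z (c *\<^sub>R v) = c *\<^sub>R hadamard s z v"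
    unfolding hadamard_def by simp
qed

text \<open>For a fixed direction this is the scaled integral with \<open>m = 0\<close>; linearity
  in the last argument then allows the moving direction \<open>h x\<close> to be expanded in
  \<open>C\<close>.\<close>

lemma smooth_on_hadamard:
  assumes "onb (B :: 'e set)" "onb (C :: 'd set)" "open S" "smooth_on S g" "smooth_on S h"
    "\<And>x. x \<in> S \<Longrightarrow> fst (g x) \<in> A"
  shows "smooth_on S (\<lambda>x. hadamard s (g x) (h x))"
proof (rule smooth_on_cong[OF assms(3)])
  have op: "open (A \<times> (UNIV :: 'd set))" by (simp add: A open_Times)
  have h: "smooth_on (A \<times> UNIV) (\<lambda>z. hadamard s z c)" for c
    using s C_k_on_scaled_integral[OF onb_Times[OF assms(1,2)] A, of _ "\<lambda>x. fderiv s x (0, c)" 0]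
      smooth_on_fderiv[OF s]
    by (simp add: hadamard_def smooth_on_def)
  have "smooth_on S (\<lambda>x. hadamard s (g x) c)" for c
    using assms(6)
    by (intro smooth_on_compose[OF onb_Times[OF assms(1,2)] assms(3) op assms(4) h])
      (auto simp: mem_Times_iff)
  then show "smooth_on S (\<lambda>x. \<Sum>c\<in>C. (h x \<bullet> c) *\<^sub>R hadamard s (g x) c)"
    by (intro smooth_on_sum[OF assms(3)] smooth_on_bilinear[OF bounded_bilinear_scaleR assms(3)]
        smooth_on_bounded_linear[OF bounded_linear_inner_left assms(3,5)])
  show "(\<Sum>c\<in>C. (h x \<bullet> c) *\<^sub>R hadamard s (g x) c) = hadamard s (g x) (h x)" if "x \<in> S" for x
    by (rule linear_onb[OF assms(2) linear_hadamard[OF assms(6)[OF that]], symmetric])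
qed

text \<open>In the direction \<open>y\<close> itself the integrand is the derivative of
  \<open>s (x, t *\<^sub>R y)\<close> with respect to \<open>t\<close>, so the fundamental theorem
  of calculus applies.\<close>

lemma hadamard_self:
  assumes "x \<in> A"
  shows "hadamard s (x, y) y = s (x, y) - s (x, 0)"
proof -
  have "((\<lambda>t. s (x, t *\<^sub>R y)) has_vector_derivative fderiv s (x, t *\<^sub>R y) (0, y)) (at t)" for t
    using has_vector_derivative_line[of s "fderiv s (x, t *\<^sub>R y)" "(x, 0)" t "(0, y)"]
      smooth_on_has_derivative[OF s, of "(x, t *\<^sub>R y)"] assms by simp
  then have "((\<lambda>t. fderiv s (x, t *\<^sub>R y) (0, y)) has_integral s (x, 1 *\<^sub>R y) - s (x, 0 *\<^sub>R y)) {0..1}"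
    by (intro fundamental_theorem_of_calculus) (auto intro: has_vector_derivative_at_within)
  then show ?thesis by (simp add: hadamard_def integral_unique)
qed

end

section \<open>Charts of the tangent bundle\<close>

definition transition :: "('a, 'e) chart \<Rightarrow> ('a, 'e) chart \<Rightarrow> 'e \<Rightarrow> 'e" where
  "transition c d = snd d \<circ> chart_inv c"

abbreviation overlap :: "('a, 'e) chart \<Rightarrow> ('a, 'e) chart \<Rightarrow> 'e set" where
  "overlap c d \<equiv> snd c ` (fst c \<inter> fst d)"

text \<open>The tangent vector at \<open>p\<close> with components \<open>v\<close> in the chart
  \<open>c\<close>. Writing vectors this way reduces statements about all charts to computations in
  one.\<close>

definition tvec_of ::
  "('a, 'e::real_normed_vector) mfd \<Rightarrow> ('a, 'e) chart \<Rightarrow> 'a \<Rightarrow> 'e \<Rightarrow> ('a, 'e) tvec" where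
  "tvec_of N c p v = (p, \<lambda>d. if d \<in> charts_at N p then fderiv (transition c d) (snd c p) v else 0)"

text \<open>The weak notion that both \<open>M\<close> and \<open>TM\<close> are shown to satisfy; it spares the verification
  of the Hausdorff property and of paracompactness for \<open>TM\<close>.\<close>

locale smooth_charts =
  fixes N :: "('a, 'e::{real_inner,banach}) mfd" and B :: "'e set"
  assumes onb: "onb B"
    and Union_charts: "(\<Union>c\<in>atlas N. fst c) = points N"
    and openin_chart: "c \<in> atlas N \<Longrightarrow> openin (mtop N) (fst c)"
    and inj_on_chart: "c \<in> atlas N \<Longrightarrow> inj_on (snd c) (fst c)"
    and continuous_map_chart:
      "c \<in> atlas N \<Longrightarrow> continuous_map (subtopology (mtop N) (fst c)) euclidean (snd c)"
    and open_overlap: "c \<in> atlas N \<Longrightarrow> d \<in> atlas N \<Longrightarrow> open (overlap c d)"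
    and smooth_transition:
      "c \<in> atlas N \<Longrightarrow> d \<in> atlas N \<Longrightarrow> smooth_on (overlap c d) (transition c d)"

lemma smooth_charts_manifold:
  assumes "smooth_manifold N" "onb B"
  shows "smooth_charts N B"
proof
  have at: "smooth_atlas (mtop N) (atlas N)" using assms(1) by (simp add: smooth_manifold_def)
  then show "(\<Union>c\<in>atlas N. fst c) = points N" by (simp add: smooth_atlas_def)
  fix c assume c: "c \<in> atlas N"
  have ch: "is_chart (mtop N) c" using at c by (simp add: smooth_atlas_def)
  then show oc: "openin (mtop N) (fst c)" by (simp add: is_chart_def)
  have top: "topspace (subtopology (mtop N) (fst c)) = fst c"
    using oc openin_subset by fastforce
  have hm: "homeomorphic_map (subtopology (mtop N) (fst c)) (top_of_set (snd c ` fst c)) (snd c)"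
    using ch by (simp add: is_chart_def)
  show "inj_on (snd c) (fst c)"
    using homeomorphic_imp_injective_map[OF hm] top by simp
  show cm: "continuous_map (subtopology (mtop N) (fst c)) euclidean (snd c)"
    using homeomorphic_imp_continuous_map[OF hm] continuous_map_in_subtopology by blast
  fix d assume d: "d \<in> atlas N"
  show "smooth_on (overlap c d) (transition c d)"
    using at c d by (simp add: smooth_atlas_def transition_def)
  have "openin (mtop N) (fst d)" using at d by (simp add: smooth_atlas_def is_chart_def)
  then have "openin (subtopology (mtop N) (fst c)) (fst c \<inter> fst d)"
    by (simp add: openin_subtopology_Int2)
  then have "openin (top_of_set (snd c ` fst c)) (overlap c d)"
    using homeomorphic_imp_open_map[OF hm] by (simp add: open_map_def)
  moreover have "open (snd c ` fst c)" using ch by (simp add: is_chart_def)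
  ultimately show "open (overlap c d)" using openin_open_trans by blast
qed (fact assms(2))

lemma tproj_tvec_of [simp]: "tproj (tvec_of N c p v) = p"
  by (simp add: tvec_of_def tproj_def)

lemma tangent_spaceD: "w \<in> tangent_space N p \<Longrightarrow> tproj w = p"
  by (auto simp: tangent_space_def tproj_def)

lemma tangent_space_zero: "w \<in> tangent_space N p \<Longrightarrow> c \<notin> charts_at N p \<Longrightarrow> snd w c = 0"
  unfolding tangent_space_def by (cases w) (simp only: mem_Collect_eq case_prod_conv snd_conv, blast)

lemma tangent_spaceI:
  assumes "tproj w = p" "\<And>c. c \<notin> charts_at N p \<Longrightarrow> snd w c = 0"
    "\<And>c d. c \<in> charts_at N p \<Longrightarrow> d \<in> charts_at N p \<Longrightarrow>
       snd w d = fderiv (transition c d) (snd c p) (snd w c)"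
  shows "w \<in> tangent_space N p"
  using assms unfolding tproj_def transition_def
  by (cases w) (simp only: tangent_space_def mem_Collect_eq case_prod_conv fst_conv snd_conv, blast)

lemma tangent_vectors_iff: "w \<in> tangent_vectors N \<longleftrightarrow> tproj w \<in> points N \<and> w \<in> tangent_space N (tproj w)"
  by (auto simp: tangent_vectors_def dest: tangent_spaceD)

context smooth_charts
begin

lemma charts_atD:
  "c \<in> charts_at N p \<Longrightarrow> c \<in> atlas N" "c \<in> charts_at N p \<Longrightarrow> p \<in> fst c"
  by (auto simp: charts_at_def)

lemma charts_at_points: "c \<in> charts_at N p \<Longrightarrow> p \<in> points N"
  using Union_charts by (auto simp: charts_at_def)

lemma ex_chart: "p \<in> points N \<Longrightarrow> \<exists>c. c \<in> charts_at N p"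
  using Union_charts unfolding charts_at_def by blast

lemma open_chart_image: "c \<in> atlas N \<Longrightarrow> open (snd c ` fst c)"
  using open_overlap[of c c] by simp

lemma chart_inv_chart [simp]: "c \<in> atlas N \<Longrightarrow> p \<in> fst c \<Longrightarrow> chart_inv c (snd c p) = p"
  using inj_on_chart by (simp add: chart_inv_def)

lemma transition_chart [simp]:
  "c \<in> atlas N \<Longrightarrow> p \<in> fst c \<Longrightarrow> transition c d (snd c p) = snd d p"
  by (simp add: transition_def)

lemma chart_inv_in:
  "x \<in> snd c ` fst c \<Longrightarrow> chart_inv c x \<in> fst c \<and> snd c (chart_inv c x) = x"
  by (simp add: chart_inv_def inv_into_into f_inv_into_f)

lemma chart_image_Int:
  assumes "c \<in> atlas N" "U \<subseteq> fst c" "V \<subseteq> fst c"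
  shows "snd c ` (U \<inter> V) = snd c ` U \<inter> snd c ` V"
  using inj_on_image_Int[OF inj_on_chart[OF assms(1)] assms(2,3)] .

lemma transition_has_derivative:
  assumes "c \<in> charts_at N p" "d \<in> charts_at N p"
  shows "(transition c d has_derivative fderiv (transition c d) (snd c p)) (at (snd c p))"
  using assms smooth_on_has_derivative[OF smooth_transition] by (auto simp: charts_at_def)

lemma linear_fderiv_transition:
  assumes "c \<in> charts_at N p" "d \<in> charts_at N p"
  shows "linear (fderiv (transition c d) (snd c p))"
  using transition_has_derivative[OF assms] has_derivative_linear by blast

text \<open>The chain rule, in the form that makes \<open>tvec_of\<close> obey the transformation
  law between any two charts.\<close>

lemma fderiv_transition_cocycle:
  assumes "c \<in> charts_at N p" "d \<in> charts_at N p" "e \<in> charts_at N p"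
  shows "fderiv (transition c e) (snd c p) v =
    fderiv (transition d e) (snd d p) (fderiv (transition c d) (snd c p) v)"
proof (rule fun_cong[OF fderiv_eqI])
  have at: "c \<in> atlas N" "d \<in> atlas N" "e \<in> atlas N" "p \<in> fst c" "p \<in> fst d" "p \<in> fst e"
    using assms by (auto simp: charts_at_def)
  have "((\<lambda>x. transition d e (transition c d x)) has_derivative
    (\<lambda>v. fderiv (transition d e) (snd d p) (fderiv (transition c d) (snd c p) v))) (at (snd c p))"
    using transition_has_derivative[OF assms(2,3)] at
    by (intro has_derivative_compose[OF transition_has_derivative[OF assms(1,2)]]) auto
  then show "(transition c e has_derivative
    (\<lambda>v. fderiv (transition d e) (snd d p) (fderiv (transition c d) (snd c p) v))) (at (snd c p))"
  proof (rule has_derivative_transform_within_open)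
    show "open (overlap c d)" using open_overlap at by blast
    show "snd c p \<in> overlap c d" using at by blast
    show "transition d e (transition c d x) = transition c e x" if "x \<in> overlap c d" for x
      using that at by auto
  qed
qed

lemma fderiv_transition_self:
  assumes "c \<in> charts_at N p"
  shows "fderiv (transition c c) (snd c p) v = v"
proof (rule fun_cong[OF fderiv_eqI])
  have at: "c \<in> atlas N" "p \<in> fst c" using assms by (auto simp: charts_at_def)
  show "(transition c c has_derivative (\<lambda>v. v)) (at (snd c p))"
  proof (rule has_derivative_transform_within_open[OF has_derivative_ident open_chart_image[OF at(1)]])
    show "snd c p \<in> snd c ` fst c" using at by blast
    show "x = transition c c x" if "x \<in> snd c ` fst c" for x
      using chart_inv_in[OF that] by (simp add: transition_def)
  qed
qed

lemma tvec_of_component [simp]: "c \<in> charts_at N p \<Longrightarrow> snd (tvec_of N c p v) c = v"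
  unfolding tvec_of_def by (simp add: fderiv_transition_self)

lemma tvec_of_in_tangent_space:
  assumes "c \<in> charts_at N p"
  shows "tvec_of N c p v \<in> tangent_space N p"
proof (rule tangent_spaceI)
  show "snd (tvec_of N c p v) e = fderiv (transition d e) (snd d p) (snd (tvec_of N c p v) d)"
    if "d \<in> charts_at N p" "e \<in> charts_at N p" for d e
    using fderiv_transition_cocycle[OF assms that] that by (simp add: tvec_of_def)
qed (simp_all add: tvec_of_def tproj_def)

lemma tvec_of_in_tangent_vectors:
  "c \<in> charts_at N p \<Longrightarrow> tvec_of N c p v \<in> tangent_vectors N"
  using tvec_of_in_tangent_space charts_at_points unfolding tangent_vectors_def by blast

lemma tangent_component:
  assumes "w \<in> tangent_space N p" "c \<in> charts_at N p" "d \<in> charts_at N p"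
  shows "snd w d = fderiv (transition c d) (snd c p) (snd w c)"
proof -
  have "\<forall>c\<in>charts_at N p. \<forall>d\<in>charts_at N p. snd w d = fderiv (transition c d) (snd c p) (snd w c)"
    using assms(1) unfolding transition_def by (cases w) (simp only: tangent_space_def mem_Collect_eq case_prod_conv snd_conv, blast)
  then show ?thesis using assms by blast
qed

lemma tvec_of_snd:
  assumes "w \<in> tangent_space N p" "c \<in> charts_at N p"
  shows "tvec_of N c p (snd w c) = w"
proof (rule prod_eqI)
  show "fst (tvec_of N c p (snd w c)) = fst w"
    using tangent_spaceD[OF assms(1)] by (simp add: tvec_of_def tproj_def)
  show "snd (tvec_of N c p (snd w c)) = snd w"
    using tangent_component[OF assms] tangent_space_zero[OF assms(1)]
    by (auto simp: tvec_of_def)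
qed

lemma tangent_eqI:
  assumes "v \<in> tangent_space N p" "w \<in> tangent_space N p" "c \<in> charts_at N p" "snd v c = snd w c"
  shows "v = w"
  using tvec_of_snd assms by metis

lemma tadd_tvec_of:
  assumes "c \<in> charts_at N p"
  shows "tadd (tvec_of N c p v) (tvec_of N c p w) = tvec_of N c p (v + w)"
  using linear_add[OF linear_fderiv_transition[OF assms]]
  by (auto simp: tadd_def tvec_of_def tproj_def fun_eq_iff)

lemma tlincomb_tvec_of:
  assumes "c \<in> charts_at N p"
  shows "tlincomb p k a (\<lambda>i. tvec_of N c p (v i)) = tvec_of N c p (\<Sum>i<k. a i *\<^sub>R v i)"
  by (auto simp: tlincomb_def tvec_of_def fun_eq_iff linear_sum[OF linear_fderiv_transition[OF assms]]
      linear_cmul[OF linear_fderiv_transition[OF assms]])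

section \<open>The induced atlas of the tangent bundle\<close>

lemma mem_tangent_chart:
  "v \<in> fst (tangent_chart N c) \<longleftrightarrow> v \<in> tangent_vectors N \<and> tproj v \<in> fst c"
  by (simp add: tangent_chart_def)

lemma tangent_chart_apply [simp]: "snd (tangent_chart N c) v = (snd c (tproj v), snd v c)"
  by (simp add: tangent_chart_def)

lemma atlas_tangent_bundle [simp]: "atlas (tangent_bundle N) = tangent_chart N ` atlas N"
  by (simp add: tangent_bundle_def)

lemma ex_tangent_chart: "v \<in> tangent_vectors N \<Longrightarrow> \<exists>c\<in>atlas N. v \<in> fst (tangent_chart N c)"
  using ex_chart[of "tproj v"] charts_atD
  unfolding mem_tangent_chart tangent_vectors_iff[of v] by blast

lemma points_tangent_bundle [simp]: "points (tangent_bundle N) = tangent_vectors N"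
  unfolding tangent_bundle_def mfd.simps topology_generated_by_topspace
proof (intro equalityI subsetI)
  fix v assume "v \<in> tangent_vectors N"
  then obtain c where "c \<in> atlas N" "v \<in> fst (tangent_chart N c)" using ex_tangent_chart by blast
  then have "v \<in> {v \<in> fst (tangent_chart N c). snd (tangent_chart N c) v \<in> UNIV}" by simp
  then show "v \<in> \<Union> {{v \<in> fst (tangent_chart N c). snd (tangent_chart N c) v \<in> O'} |c O'.
      c \<in> atlas N \<and> open O'}"
    using \<open>c \<in> atlas N\<close> open_UNIV by blast
next
  fix v assume "v \<in> \<Union> {{v \<in> fst (tangent_chart N c). snd (tangent_chart N c) v \<in> O'} |c O'.
      c \<in> atlas N \<and> open O'}"
  then obtain c where "v \<in> fst (tangent_chart N c)" by blast
  then show "v \<in> tangent_vectors N" by (simp add: mem_tangent_chart)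
qed

lemma charts_at_tangent_bundle:
  "v \<in> tangent_vectors N \<Longrightarrow> charts_at (tangent_bundle N) v = tangent_chart N ` charts_at N (tproj v)"
  by (auto simp: charts_at_def mem_tangent_chart)

text \<open>Every component vector is realised by \<open>tvec_of\<close>. With \<open>d = c\<close>
  this identifies the image of an induced chart as a product with full fibres, the setting of
  Hadamard's lemma.\<close>

lemma overlap_tangent_chart:
  assumes "c \<in> atlas N" "d \<in> atlas N"
  shows "overlap (tangent_chart N c) (tangent_chart N d) = overlap c d \<times> UNIV"
proof
  show "overlap (tangent_chart N c) (tangent_chart N d) \<subseteq> overlap c d \<times> UNIV"
    by (auto simp: mem_tangent_chart)
  show "overlap c d \<times> UNIV \<subseteq> overlap (tangent_chart N c) (tangent_chart N d)"
  proof
    fix z assume "z \<in> overlap c d \<times> (UNIV :: 'e set)"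
    then obtain p v where z: "z = (snd c p, v)" and p: "p \<in> fst c" "p \<in> fst d" by blast
    then have "c \<in> charts_at N p" using assms by (simp add: charts_at_def)
    then show "z \<in> overlap (tangent_chart N c) (tangent_chart N d)"
      unfolding z using p tvec_of_in_tangent_vectors[of c p v]
      by (intro image_eqI[of _ _ "tvec_of N c p v"]) (auto simp: mem_tangent_chart)
  qed
qed

lemma inj_on_tangent_chart:
  assumes "c \<in> atlas N"
  shows "inj_on (snd (tangent_chart N c)) (fst (tangent_chart N c))"
proof (rule inj_onI)
  fix v w
  assume v: "v \<in> fst (tangent_chart N c)" and w: "w \<in> fst (tangent_chart N c)"
    and eq: "snd (tangent_chart N c) v = snd (tangent_chart N c) w"
  have p: "tproj v = tproj w"
    using eq inj_onD[OF inj_on_chart[OF assms]] v w by (auto simp: mem_tangent_chart)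
  show "v = w"
    using v w p assms eq
    by (intro tangent_eqI[of v "tproj v" w c])
      (auto simp: mem_tangent_chart tangent_vectors_iff charts_at_def)
qed

lemma chart_inv_tangent_chart:
  assumes "c \<in> charts_at N p"
  shows "chart_inv (tangent_chart N c) (snd c p, v) = tvec_of N c p v"
proof -
  have "chart_inv (tangent_chart N c) (snd (tangent_chart N c) (tvec_of N c p v)) = tvec_of N c p v"
    unfolding chart_inv_def using assms tvec_of_in_tangent_vectors[OF assms]
    by (intro inv_into_f_f inj_on_tangent_chart) (auto simp: mem_tangent_chart charts_at_def)
  then show ?thesis using assms by simp
qed

lemma transition_tangent_chart:
  assumes "c \<in> charts_at N p" "d \<in> charts_at N p"
  shows "transition (tangent_chart N c) (tangent_chart N d) (snd c p, v) =
    (snd d p, fderiv (transition c d) (snd c p) v)"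
  unfolding transition_def[of "tangent_chart N c"] comp_apply chart_inv_tangent_chart[OF assms(1)]
  using assms(2) by (simp add: tvec_of_def tproj_def)

lemma smooth_on_transition_fderiv:
  assumes "c \<in> atlas N" "d \<in> atlas N" "open U" "smooth_on U g" "smooth_on U h"
    "\<And>x. x \<in> U \<Longrightarrow> g x \<in> overlap c d"
  shows "smooth_on U (\<lambda>x. (transition c d (g x), fderiv (transition c d) (g x) (h x)))"
  using assms(6)
  by (intro smooth_on_Pair[OF assms(3)]
     smooth_on_compose[OF onb assms(3) open_overlap[OF assms(1,2)] assms(4) smooth_transition[OF assms(1,2)]]
     smooth_on_fderiv_compose[OF onb assms(3) open_overlap[OF assms(1,2)] smooth_transition[OF assms(1,2)] assms(4,5)])
    auto

lemma smooth_transition_tangent_chart: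
  assumes "c \<in> atlas N" "d \<in> atlas N"
  shows "smooth_on (overlap (tangent_chart N c) (tangent_chart N d))
    (transition (tangent_chart N c) (tangent_chart N d))"
  unfolding overlap_tangent_chart[OF assms]
proof (rule smooth_on_cong)
  show op: "open (overlap c d \<times> UNIV)" by (simp add: open_Times open_overlap assms)
  show "smooth_on (overlap c d \<times> UNIV) (\<lambda>z. (transition c d (fst z), fderiv (transition c d) (fst z) (snd z)))"
    by (intro smooth_on_transition_fderiv assms op smooth_on_linear bounded_linear_fst bounded_linear_snd) auto
  show "(transition c d (fst z), fderiv (transition c d) (fst z) (snd z)) =
      transition (tangent_chart N c) (tangent_chart N d) z" if z: "z \<in> overlap c d \<times> UNIV" for z
  proof -
    obtain p v where "p \<in> fst c" "p \<in> fst d" "z = (snd c p, v)" using z by auto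
    then show ?thesis
      using assms transition_tangent_chart[of c p d v] by (simp add: charts_at_def)
  qed
qed

lemma openin_tangent_bundle:
  assumes "c \<in> atlas N" "open U"
  shows "openin (mtop (tangent_bundle N)) {v \<in> fst (tangent_chart N c). snd (tangent_chart N c) v \<in> U}"
  unfolding tangent_bundle_def mfd.simps using assms by (intro topology_generated_by_Basis) blast

text \<open>The locale reproduces itself, so \<open>TTM\<close> is handled by applying to
  \<open>TM\<close> everything already proved for the tangent bundle of \<open>N\<close>.\<close>

lemma smooth_charts_tangent_bundle:
  "smooth_charts (tangent_bundle N) ((\<lambda>b. (b, 0)) ` B \<union> (\<lambda>b. (0, b)) ` B)"
proof
  show "onb ((\<lambda>b. (b, 0)) ` B \<union> (\<lambda>b. (0, b)) ` B)" by (rule onb_Times[OF onb onb])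
  show "(\<Union>c\<in>atlas (tangent_bundle N). fst c) = points (tangent_bundle N)"
    unfolding points_tangent_bundle atlas_tangent_bundle
    using ex_tangent_chart mem_tangent_chart by blast
next
  fix C assume "C \<in> atlas (tangent_bundle N)"
  then obtain c where c: "c \<in> atlas N" "C = tangent_chart N c" by auto
  show o: "openin (mtop (tangent_bundle N)) (fst C)"
    using openin_tangent_bundle[OF c(1) open_UNIV] c by simp
  show "inj_on (snd C) (fst C)" using inj_on_tangent_chart c by simp
  have top: "topspace (subtopology (mtop (tangent_bundle N)) (fst C)) = fst C"
    using openin_subset[OF o] by auto
  show "continuous_map (subtopology (mtop (tangent_bundle N)) (fst C)) euclidean (snd C)"
    unfolding continuous_map_def top openin_open_subtopology[OF o]
    using openin_tangent_bundle[OF c(1)] c(2) by (auto simp del: tangent_chart_apply)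
  fix D assume "D \<in> atlas (tangent_bundle N)"
  then obtain d where d: "d \<in> atlas N" "D = tangent_chart N d" by auto
  show "open (overlap C D)"
    using c d by (simp only: overlap_tangent_chart) (simp add: open_Times open_overlap)
  show "smooth_on (overlap C D) (transition C D)"
    using c d smooth_transition_tangent_chart by simp
qed

text \<open>\<open>smooth_map_on\<close> quantifies over all pairs of charts, so smooth components
  in the single chart \<open>c\<close> have to be compared with every other chart. Applied to
  \<open>TM\<close>, this provides the local frames of the connection.\<close>

lemma smooth_vector_field_chart:
  assumes c: "c \<in> atlas N" and f: "smooth_on (snd c ` fst c) f"
  shows "smooth_vector_field_on N (fst c) (\<lambda>q. tvec_of N c q (f (snd c q)))"
  unfolding smooth_vector_field_on_def smooth_map_on_def
proof (intro conjI ballI)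
  let ?X = "\<lambda>q. tvec_of N c q (f (snd c q))"
  let ?T = "subtopology (mtop N) (fst c)"
  show oc: "openin (mtop N) (fst c)" by (rule openin_chart[OF c])
  have top: "topspace ?T = fst c" using openin_subset[OF oc] by auto
  have X_in: "?X q \<in> tangent_vectors N" if "q \<in> fst c" for q
    using that c tvec_of_in_tangent_vectors by (simp add: charts_at_def)
  have X_chart: "snd (tangent_chart N d) (?X q) = (transition c d (snd c q), fderiv (transition c d) (snd c q) (f (snd c q)))"
    if "q \<in> fst c" "q \<in> fst d" "d \<in> atlas N" for q d
    using that c by (simp add: tvec_of_def charts_at_def tproj_def)
  show "continuous_map ?T (mtop (tangent_bundle N)) ?X"
    unfolding tangent_bundle_def mfd.simps
  proof (rule continuous_on_generated_topo)
    have "?X q \<in> points (tangent_bundle N)" if "q \<in> fst c" for q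
      using X_in[OF that] by simp
    then show "?X ` topspace ?T \<subseteq> \<Union> {{v \<in> fst (tangent_chart N c). snd (tangent_chart N c) v \<in> O'} |c O'.
       c \<in> atlas N \<and> open O'}"
      unfolding top tangent_bundle_def mfd.simps topology_generated_by_topspace by blast
    fix U assume "U \<in> {{v \<in> fst (tangent_chart N c). snd (tangent_chart N c) v \<in> O'} |c O'.
       c \<in> atlas N \<and> open O'}"
    then obtain d O' where d: "d \<in> atlas N" "open O'"
      and U: "U = {v \<in> fst (tangent_chart N d). snd (tangent_chart N d) v \<in> O'}" by blast
    let ?g = "\<lambda>x. (transition c d x, fderiv (transition c d) x (f x))"
    have "continuous_on (overlap c d) ?g"
      by (intro smooth_on_continuous smooth_on_transition_fderiv c d open_overlap smooth_on_ident
          smooth_on_subset[OF f]) auto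
    then have "open (overlap c d \<inter> ?g -` O')"
      using d open_overlap[OF c d(1)] by (simp add: continuous_open_preimage)
    then have "openin ?T {q \<in> topspace ?T. snd c q \<in> overlap c d \<inter> ?g -` O'}"
      by (intro openin_continuous_map_preimage[OF continuous_map_chart[OF c]]) simp
    moreover have "{q \<in> topspace ?T. snd c q \<in> overlap c d \<inter> ?g -` O'} = ?X -` U \<inter> topspace ?T"
    proof -
      have "snd c q \<in> overlap c d \<longleftrightarrow> q \<in> fst d" if "q \<in> fst c" for q
        using that inj_on_chart[OF c] by (auto dest: inj_onD)
      moreover have "?X q \<in> U \<longleftrightarrow> q \<in> fst d \<and> ?g (snd c q) \<in> O'" if "q \<in> fst c" for q
        using X_chart[OF that _ d(1)] X_in[OF that] unfolding U
        by (auto simp: mem_tangent_chart simp del: tangent_chart_apply)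
      ultimately show ?thesis unfolding top vimage_def by blast
    qed
    ultimately show "openin ?T (?X -` U \<inter> topspace ?T)" by simp
  qed
  fix c' D assume c': "c' \<in> atlas N" and "D \<in> atlas (tangent_bundle N)"
  then obtain d where d: "d \<in> atlas N" "D = tangent_chart N d" by auto
  have set: "{p \<in> fst c \<inter> fst c'. ?X p \<in> fst D} = (fst c' \<inter> fst c) \<inter> (fst c' \<inter> fst d)"
    using X_in d by (auto simp: mem_tangent_chart)
  let ?U = "snd c' ` {p \<in> fst c \<inter> fst c'. ?X p \<in> fst D}"
  have U: "?U = overlap c' c \<inter> overlap c' d"
    unfolding set by (intro chart_image_Int c') auto
  have op: "open ?U" unfolding U using open_overlap c c' d by blast
  have sub: "?U \<subseteq> overlap c' c" unfolding U by blast
  \<comment> \<open>The coordinate expression goes from \<open>c'\<close> to \<open>c\<close>, where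
    the components are \<open>f\<close>, and then to \<open>d\<close> by the derivative of the
    transition.\<close>
  show "smooth_on ?U (snd D \<circ> ?X \<circ> chart_inv c')"
  proof (rule smooth_on_cong[OF op])
    have tr: "smooth_on ?U (transition c' c)"
      by (rule smooth_on_subset[OF smooth_transition[OF c' c] sub])
    have tr_in: "transition c' c x \<in> overlap c d" if "x \<in> ?U" for x
      using that c' unfolding set by auto
    have "smooth_on ?U (\<lambda>x. f (transition c' c x))"
      by (rule smooth_on_compose[OF onb op open_chart_image[OF c] tr f]) (use tr_in in auto)
    then show "smooth_on ?U (\<lambda>x. (transition c d (transition c' c x),
       fderiv (transition c d) (transition c' c x) (f (transition c' c x))))"
      using tr_in by (intro smooth_on_transition_fderiv c d op tr)
    show "(transition c d (transition c' c x), fderiv (transition c d) (transition c' c x) (f (transition c' c x))) =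
        (snd D \<circ> ?X \<circ> chart_inv c') x" if "x \<in> ?U" for x
    proof -
      obtain p where "x = snd c' p" "p \<in> fst c" "p \<in> fst c'" "p \<in> fst d"
        using \<open>x \<in> ?U\<close> unfolding set by blast
      then show ?thesis using X_chart[of p d] d c' by (simp del: tangent_chart_apply)
    qed
  qed
qed simp

end

section \<open>Second derivatives of coordinate changes and the projection from
  \<open>TTM\<close>\<close>

context smooth_charts
begin

lemma has_derivative_fderiv_transition:
  assumes "c \<in> charts_at N p" "d \<in> charts_at N p"
  shows "((\<lambda>z. fderiv (transition c d) (fst z) (snd z)) has_derivative
    (\<lambda>w. fderiv (\<lambda>x. fderiv (transition c d) x y) (snd c p) (fst w) +
          fderiv (transition c d) (snd c p) (snd w))) (at (snd c p, y))"
proof -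
  let ?\<phi> = "transition c d" and ?x = "snd c p"
  let ?g = "\<lambda>z. fderiv ?\<phi> (fst z) (snd z)"
  have at: "c \<in> atlas N" "d \<in> atlas N" "?x \<in> overlap c d" using assms by (auto simp: charts_at_def)
  have op: "open (overlap c d \<times> (UNIV :: 'e set))" by (simp add: open_Times open_overlap at)
  have "smooth_on (overlap c d \<times> UNIV) ?g"
    by (intro smooth_on_fderiv_compose[OF onb op open_overlap[OF at(1,2)] smooth_transition[OF at(1,2)]]
        smooth_on_linear op bounded_linear_fst bounded_linear_snd) auto
  then have g: "(?g has_derivative fderiv ?g (?x, y)) (at (?x, y))"
    using at by (intro smooth_on_has_derivative[of "overlap c d \<times> UNIV"]) auto
  \<comment> \<open>The total derivative exists by smoothness; restriction to the two coordinate
    slices identifies its partial derivatives.\<close>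
  have "((\<lambda>x. ?g (x, y)) has_derivative (\<lambda>X. fderiv ?g (?x, y) (X, 0))) (at ?x)"
    using has_derivative_compose[of "\<lambda>x. (x, y)" "\<lambda>X. (X, 0)" ?x UNIV ?g,
        OF has_derivative_Pair[OF has_derivative_ident has_derivative_const] g] by simp
  then have 1: "fderiv (\<lambda>x. fderiv ?\<phi> x y) ?x = (\<lambda>X. fderiv ?g (?x, y) (X, 0))"
    unfolding fst_conv snd_conv by (rule fderiv_eqI)
  have g_snd: "((\<lambda>y. ?g (?x, y)) has_derivative (\<lambda>Y. fderiv ?g (?x, y) (0, Y))) (at y)"
    using has_derivative_compose[of "\<lambda>y. (?x, y)" "\<lambda>Y. (0, Y)" y UNIV ?g,
        OF has_derivative_Pair[OF has_derivative_const has_derivative_ident] g] by simp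
  have "(fderiv ?\<phi> ?x has_derivative fderiv ?\<phi> ?x) (at y)"
    using transition_has_derivative[OF assms] has_derivative_bounded_linear
      bounded_linear_imp_has_derivative by blast
  then have 2: "fderiv ?\<phi> ?x = (\<lambda>Y. fderiv ?g (?x, y) (0, Y))"
    using g_snd unfolding fst_conv snd_conv by (rule has_derivative_unique)
  have "fderiv ?g (?x, y) w = fderiv (\<lambda>x. fderiv ?\<phi> x y) ?x (fst w) + fderiv ?\<phi> ?x (snd w)" for w
    using linear_add[OF has_derivative_linear[OF g], of "(fst w, 0)" "(0, snd w)"]
      fun_cong[OF 1] fun_cong[OF 2] by simp
  then show ?thesis by (intro has_derivative_eq_rhs[OF g] ext)
qed

lemma fderiv_transition_tangent_chart:
  assumes "c \<in> charts_at N p" "d \<in> charts_at N p"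
  shows "fderiv (transition (tangent_chart N c) (tangent_chart N d)) (snd c p, y) (X, Y) =
    (fderiv (transition c d) (snd c p) X,
     fderiv (\<lambda>x. fderiv (transition c d) x y) (snd c p) X + fderiv (transition c d) (snd c p) Y)"
proof -
  let ?\<phi> = "transition c d" and ?x = "snd c p"
  let ?g = "\<lambda>z. fderiv ?\<phi> (fst z) (snd z)"
  have at: "c \<in> atlas N" "d \<in> atlas N" "?x \<in> overlap c d" using assms by (auto simp: charts_at_def)
  have op: "open (overlap c d \<times> (UNIV :: 'e set))" by (simp add: open_Times open_overlap at)
  have "((\<lambda>z. ?\<phi> (fst z)) has_derivative (\<lambda>w. fderiv ?\<phi> ?x (fst w))) (at (?x, y))"
    by (rule has_derivative_compose[of fst fst _ UNIV])
      (use transition_has_derivative[OF assms] in \<open>auto intro!: derivative_eq_intros\<close>)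
  from has_derivative_Pair[OF this has_derivative_fderiv_transition[OF assms]]
  have "(transition (tangent_chart N c) (tangent_chart N d) has_derivative
     (\<lambda>w. (fderiv ?\<phi> ?x (fst w), fderiv (\<lambda>x. fderiv ?\<phi> x y) ?x (fst w) + fderiv ?\<phi> ?x (snd w))))
     (at (?x, y))"
  proof (rule has_derivative_transform_within_open[OF _ op])
    show "(?x, y) \<in> overlap c d \<times> UNIV" using at by simp
    show "(?\<phi> (fst z), ?g z) = transition (tangent_chart N c) (tangent_chart N d) z"
      if z: "z \<in> overlap c d \<times> UNIV" for z
    proof -
      obtain q v where "q \<in> fst c" "q \<in> fst d" "z = (snd c q, v)" using z by auto
      then show ?thesis
        using at transition_tangent_chart[of c q d v] by (simp add: charts_at_def)
    qed
  qed
  from fun_cong[OF fderiv_eqI[OF this], of "(X, Y)"]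
  show ?thesis by simp
qed

text \<open>\<open>tangent_map\<close> is computed in an arbitrarily chosen chart. Since the
  projection in coordinates is the first component of a transition map, the transformation law of
  \<open>w\<close> removes the choice.\<close>

lemma tproj_star_eq:
  assumes "w \<in> tangent_vectors (tangent_bundle N)"
  shows "tproj_star N w = (tproj (tproj w),
    \<lambda>d. if d \<in> charts_at N (tproj (tproj w)) then fst (snd w (tangent_chart N d)) else 0)"
proof -
  interpret T: smooth_charts "tangent_bundle N" "(\<lambda>b. (b, 0)) ` B \<union> (\<lambda>b. (0, b)) ` B"
    by (rule smooth_charts_tangent_bundle)
  define C where "C = (SOME C. C \<in> charts_at (tangent_bundle N) (tproj w))"
  have w: "w \<in> tangent_space (tangent_bundle N) (tproj w)" "tproj w \<in> tangent_vectors N"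
    using assms by (simp_all add: tangent_vectors_iff[of w])
  then have C: "C \<in> charts_at (tangent_bundle N) (tproj w)"
    unfolding C_def using someI_ex[OF T.ex_chart[of "tproj w"]] points_tangent_bundle by blast
  have "fderiv (snd d \<circ> tproj \<circ> chart_inv C) (snd C (tproj w)) (snd w C) = fst (snd w (tangent_chart N d))"
    if d: "d \<in> charts_at N (tproj (tproj w))" for d
  proof -
    have D: "tangent_chart N d \<in> charts_at (tangent_bundle N) (tproj w)"
      using d w(2) by (simp add: charts_at_tangent_bundle)
    have "snd d \<circ> tproj \<circ> chart_inv C = (\<lambda>z. fst (transition C (tangent_chart N d) z))"
      by (simp add: transition_def fun_eq_iff)
    moreover have "((\<lambda>z. fst (transition C (tangent_chart N d) z)) has_derivative
       (\<lambda>v. fst (fderiv (transition C (tangent_chart N d)) (snd C (tproj w)) v))) (at (snd C (tproj w)))"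
      by (intro has_derivative_fst T.transition_has_derivative C D)
    ultimately have "fderiv (snd d \<circ> tproj \<circ> chart_inv C) (snd C (tproj w)) (snd w C) =
       fst (fderiv (transition C (tangent_chart N d)) (snd C (tproj w)) (snd w C))"
      using fderiv_eqI by metis
    then show ?thesis using T.tangent_component[OF w(1) C D] by simp
  qed
  then show ?thesis
    unfolding tangent_map_def Let_def C_def[symmetric] by auto
qed

end

section \<open>The connection of a quasispray\<close>

lemma has_integral_linear_ramp:
  fixes c :: "'a::banach"
  shows "((\<lambda>t. (2 * t) *\<^sub>R c) has_integral c) {0..1}"
proof -
  have "((\<lambda>t. (2 * t) *\<^sub>R c) has_integral ((1::real)\<^sup>2 *\<^sub>R c - 0\<^sup>2 *\<^sub>R c)) {0..1}"
    by (intro fundamental_theorem_of_calculus)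
      (auto simp: has_vector_derivative_def intro!: derivative_eq_intros)
  then show ?thesis by simp
qed

locale quasispray_charts = smooth_charts M B
  for M :: "('a, 'e::{real_inner,banach}) mfd" and B :: "'e set" +
  fixes S :: "('a, 'e) tvec \<Rightarrow> (('a, 'e) tvec, 'e \<times> 'e) tvec"
  assumes quasispray: "quasispray M S"
begin

sublocale T: smooth_charts "tangent_bundle M" "(\<lambda>b. (b, 0)) ` B \<union> (\<lambda>b. (0, b)) ` B"
  by (rule smooth_charts_tangent_bundle)

text \<open>The local function \<open>s\<close> of the overview, in the chart
  \<open>c\<close>.\<close>

definition spray_coeff :: "('a, 'e) chart \<Rightarrow> 'e \<times> 'e \<Rightarrow> 'e" where
  "spray_coeff c z = snd (snd (S (chart_inv (tangent_chart M c) z)) (tangent_chart M c))"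

abbreviation conn_coeff :: "('a, 'e) chart \<Rightarrow> 'e \<times> 'e \<Rightarrow> 'e \<Rightarrow> 'e" where
  "conn_coeff c \<equiv> hadamard (spray_coeff c)"

abbreviation transition_hessian :: "('a, 'e) chart \<Rightarrow> ('a, 'e) chart \<Rightarrow> 'e \<Rightarrow> 'e \<Rightarrow> 'e \<Rightarrow> 'e" where
  "transition_hessian c d x y v \<equiv> fderiv (\<lambda>x. fderiv (transition c d) x y) x v"

lemma S_in_tangent_space:
  assumes "v \<in> tangent_vectors M"
  shows "S v \<in> tangent_space (tangent_bundle M) v"
proof -
  have "continuous_map (subtopology (mtop (tangent_bundle M)) (tangent_vectors M))
      (mtop (tangent_bundle (tangent_bundle M))) S"
    using quasispray by (simp add: quasispray_def SODE_def smooth_map_on_def)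
  \<comment> \<open>That \<open>S\<close> takes values in \<open>TTM\<close> is not a separate
    clause of \<open>SODE\<close>; it is contained in continuity into that space.\<close>
  from continuous_map_funspace[OF this]
  have "S v \<in> tangent_vectors (tangent_bundle M)" using assms by (auto simp: Pi_iff)
  moreover have "tproj (S v) = v" using quasispray assms by (simp add: quasispray_def SODE_def)
  ultimately show ?thesis by (simp add: tangent_vectors_iff[of "S v"])
qed

lemma S_in_tangent_vectors:
  "v \<in> tangent_vectors M \<Longrightarrow> S v \<in> tangent_vectors (tangent_bundle M)"
  using S_in_tangent_space unfolding tangent_vectors_def[of "tangent_bundle M"] points_tangent_bundle
  by blast

lemma tproj_S: "v \<in> tangent_vectors M \<Longrightarrow> tproj (S v) = v"
  using quasispray by (simp add: quasispray_def SODE_def)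

lemma tproj_star_S: "v \<in> tangent_vectors M \<Longrightarrow> tproj_star M (S v) = v"
  using quasispray by (simp add: quasispray_def SODE_def)

lemma tangent_chart_in_charts_at:
  "v \<in> tangent_vectors M \<Longrightarrow> c \<in> charts_at M (tproj v) \<Longrightarrow>
    tangent_chart M c \<in> charts_at (tangent_bundle M) v"
  by (simp add: charts_at_tangent_bundle)

text \<open>The condition on \<open>tproj_star\<close> forces the first component to be the fibre
  coordinate, leaving \<open>spray_coeff\<close> as the only free part.\<close>

lemma S_component:
  assumes "v \<in> tangent_vectors M" "c \<in> charts_at M (tproj v)"
  shows "snd (S v) (tangent_chart M c) = (snd v c, spray_coeff c (snd (tangent_chart M c) v))"
proof -
  have "snd (tproj_star M (S v)) c = fst (snd (S v) (tangent_chart M c))"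
    using assms by (simp add: tproj_star_eq S_in_tangent_vectors tproj_S)
  then have "fst (snd (S v) (tangent_chart M c)) = snd v c"
    using tproj_star_S[OF assms(1)] by simp
  moreover have inv: "chart_inv (tangent_chart M c) (snd (tangent_chart M c) v) = v"
    using T.chart_inv_chart tangent_chart_in_charts_at[OF assms]
    by (simp only: T.charts_atD)
  ultimately show ?thesis unfolding spray_coeff_def inv by (intro prod_eqI) simp_all
qed

text \<open>The condition on the zero section enters here; it is what removes the boundary term in
  \<open>hadamard_self\<close>.\<close>

lemma spray_coeff_zero:
  assumes "c \<in> charts_at M p"
  shows "spray_coeff c (snd c p, 0) = 0"
proof -
  have "tvec_of M c p 0 = tzero p"
    using linear_0[OF linear_fderiv_transition[OF assms]] by (auto simp: tvec_of_def tzero_def fun_eq_iff)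
  moreover have "S (tzero p) = tzero (tzero p)"
    using quasispray charts_at_points[OF assms] by (simp add: quasispray_def)
  ultimately show ?thesis
    by (simp add: spray_coeff_def chart_inv_tangent_chart[OF assms]) (simp add: tzero_def)
qed

lemma smooth_spray_coeff:
  assumes "c \<in> atlas M"
  shows "smooth_on (snd c ` fst c \<times> UNIV) (spray_coeff c)"
proof -
  let ?C = "tangent_chart M c"
  \<comment> \<open>As \<open>S v\<close> lies over \<open>v\<close>, no part of the chart domain is
    lost, and smoothness holds on all of the product.\<close>
  have "{v \<in> tangent_vectors M \<inter> fst ?C. S v \<in> fst (tangent_chart (tangent_bundle M) ?C)} = fst ?C"
    using S_in_tangent_vectors tproj_S by (auto simp: mem_tangent_chart T.mem_tangent_chart)
  moreover have "snd ?C ` fst ?C = snd c ` fst c \<times> UNIV"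
    using overlap_tangent_chart[OF assms assms] by simp
  moreover have "smooth_on (snd ?C ` {v \<in> tangent_vectors M \<inter> fst ?C. S v \<in> fst (tangent_chart (tangent_bundle M) ?C)})
     (snd (tangent_chart (tangent_bundle M) ?C) \<circ> S \<circ> chart_inv ?C)"
    using quasispray assms by (simp add: quasispray_def SODE_def smooth_map_on_def)
  ultimately have "smooth_on (snd c ` fst c \<times> UNIV)
     (snd (tangent_chart (tangent_bundle M) ?C) \<circ> S \<circ> chart_inv ?C)" by simp
  from smooth_on_bounded_linear[OF bounded_linear_compose[OF bounded_linear_snd bounded_linear_snd] _ this]
  show ?thesis
    using open_chart_image[OF assms] by (simp add: open_Times spray_coeff_def[abs_def])
qed

text \<open>The transformation law of \<open>TTM\<close> at \<open>S v\<close>. The base vector and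
  the first component of \<open>S v\<close> are both \<open>y\<close>, so the Hessian is evaluated
  on the diagonal.\<close>

lemma spray_coeff_transform:
  assumes "c \<in> charts_at M p" "d \<in> charts_at M p"
  shows "spray_coeff d (snd d p, fderiv (transition c d) (snd c p) y) =
    transition_hessian c d (snd c p) y y + fderiv (transition c d) (snd c p) (spray_coeff c (snd c p, y))"
proof -
  let ?v = "tvec_of M c p y"
  have v: "?v \<in> tangent_vectors M" by (rule tvec_of_in_tangent_vectors[OF assms(1)])
  have snd_d: "snd ?v d = fderiv (transition c d) (snd c p) y"
    using assms(2) by (simp add: tvec_of_def)
  have comp: "snd (S ?v) (tangent_chart M c) = (y, spray_coeff c (snd c p, y))"
    "snd (S ?v) (tangent_chart M d) = (snd ?v d, spray_coeff d (snd d p, snd ?v d))"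
    using S_component[OF v] assms by simp_all
  have "snd (S ?v) (tangent_chart M d) =
     fderiv (transition (tangent_chart M c) (tangent_chart M d)) (snd (tangent_chart M c) ?v)
       (snd (S ?v) (tangent_chart M c))"
    using assms by (intro T.tangent_component[OF S_in_tangent_space[OF v]] tangent_chart_in_charts_at v) simp_all
  then show ?thesis
    using assms by (simp add: comp fderiv_transition_tangent_chart snd_d)
qed

section \<open>Symmetry of the Hessian and the transformation law of the coefficients\<close>

context
  fixes c d p
  assumes c: "c \<in> charts_at M p" and d: "d \<in> charts_at M p"
begin

lemma spray_coeff_has_derivative:
  assumes "e \<in> charts_at M p"
  shows "(spray_coeff e has_derivative fderiv (spray_coeff e) (snd e p, y)) (at (snd e p, y))"
  using assms by (intro smooth_on_has_derivative[OF smooth_spray_coeff[of e]]) (auto simp: charts_at_def)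

lemma hessian_symmetric:
  "transition_hessian c d (snd c p) u v = transition_hessian c d (snd c p) v u"
proof (rule fderiv_symmetric)
  show "open (overlap c d)" "snd c p \<in> overlap c d" "C_k_on (Suc (Suc 0)) (overlap c d) (transition c d)"
    using c d open_overlap smooth_transition[of c d] unfolding charts_at_def smooth_on_def by auto
qed

text \<open>Linearity in the direction of the outer derivative; linearity in the other argument
  follows from it by symmetry.\<close>

lemma hessian_linear: "linear (transition_hessian c d (snd c p) y)"
proof -
  have "smooth_on (overlap c d) (\<lambda>x. fderiv (transition c d) x y)"
    using c d by (intro smooth_on_fderiv smooth_transition) (auto simp: charts_at_def)
  moreover have "snd c p \<in> overlap c d" using c d by (auto simp: charts_at_def)
  ultimately show ?thesis using smooth_on_has_derivative has_derivative_linear by blast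
qed

text \<open>Differentiating \<open>spray_coeff_transform\<close> in the direction \<open>v\<close> produces the Hessian twice, by symmetry; since the
  Hessian is linear in \<open>y\<close>, the integral of \<open>2 t\<close> over the unit interval removes this factor.\<close>

lemma fderiv_spray_coeff_transform:
  "fderiv (spray_coeff d) (snd d p, fderiv (transition c d) (snd c p) y) (0, fderiv (transition c d) (snd c p) v) =
    2 *\<^sub>R transition_hessian c d (snd c p) y v +
    fderiv (transition c d) (snd c p) (fderiv (spray_coeff c) (snd c p, y) (0, v))"
proof -
  let ?D = "fderiv (transition c d) (snd c p)" and ?h = "transition_hessian c d (snd c p)"
  note linD = linear_fderiv_transition[OF c d]
  have bD: "bounded_linear ?D"
    using transition_has_derivative[OF c d] has_derivative_bounded_linear by blast
  have h_left: "?h (u + t *\<^sub>R w) a = ?h u a + t *\<^sub>R ?h w a" for u w a t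
    by (simp add: hessian_symmetric[of _ a] linear_add[OF hessian_linear] linear_cmul[OF hessian_linear])
  have h_right: "?h a (u + t *\<^sub>R w) = ?h a u + t *\<^sub>R ?h a w" for u w a t
    by (simp add: linear_add[OF hessian_linear] linear_cmul[OF hessian_linear])
  have "((\<lambda>t. spray_coeff d ((snd d p, ?D y) + t *\<^sub>R (0, ?D v))) has_vector_derivative
      fderiv (spray_coeff d) (snd d p, ?D y) (0, ?D v)) (at 0)"
    using spray_coeff_has_derivative[OF d] by (intro has_vector_derivative_line) simp
  \<comment> \<open>Along the line \<open>y + t *\<^sub>R v\<close> the Hessian term is a quadratic
    polynomial in \<open>t\<close>; symmetry merges the two mixed terms, and only their coefficient
    survives differentiation at 0.\<close>
  moreover have "spray_coeff d ((snd d p, ?D y) + t *\<^sub>R (0, ?D v)) =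
     (?h y y + (2 * t) *\<^sub>R ?h y v + t\<^sup>2 *\<^sub>R ?h v v) + ?D (spray_coeff c ((snd c p, y) + t *\<^sub>R (0, v)))" for t
  proof -
    have "(snd d p, ?D y) + t *\<^sub>R (0, ?D v) = (snd d p, ?D (y + t *\<^sub>R v))"
      by (simp add: linear_add[OF linD] linear_cmul[OF linD])
    then have "spray_coeff d ((snd d p, ?D y) + t *\<^sub>R (0, ?D v)) =
      ?h (y + t *\<^sub>R v) (y + t *\<^sub>R v) + ?D (spray_coeff c (snd c p, y + t *\<^sub>R v))"
      using spray_coeff_transform[OF c d] by simp
    moreover have "?h (y + t *\<^sub>R v) (y + t *\<^sub>R v) = ?h y y + (2 * t) *\<^sub>R ?h y v + t\<^sup>2 *\<^sub>R ?h v v"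
      using hessian_symmetric[of v y]
      by (simp only: h_left h_right) (simp add: algebra_simps power2_eq_square scaleR_2 flip: scaleR_scaleR)
    ultimately show ?thesis by simp
  qed
  ultimately have 1: "((\<lambda>t. (?h y y + (2 * t) *\<^sub>R ?h y v + t\<^sup>2 *\<^sub>R ?h v v) +
       ?D (spray_coeff c ((snd c p, y) + t *\<^sub>R (0, v)))) has_vector_derivative
      fderiv (spray_coeff d) (snd d p, ?D y) (0, ?D v)) (at 0)" by simp
  have "((\<lambda>t. ?h y y + (2 * t) *\<^sub>R ?h y v + t\<^sup>2 *\<^sub>R ?h v v) has_vector_derivative 2 *\<^sub>R ?h y v) (at 0)"
    unfolding has_vector_derivative_def by (auto intro!: derivative_eq_intros)
  moreover have "((\<lambda>t. ?D (spray_coeff c ((snd c p, y) + t *\<^sub>R (0, v)))) has_vector_derivative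
      ?D (fderiv (spray_coeff c) (snd c p, y) (0, v))) (at 0)"
    using spray_coeff_has_derivative[OF c]
    by (intro bounded_linear.has_vector_derivative[OF bD] has_vector_derivative_line) simp
  ultimately have "((\<lambda>t. (?h y y + (2 * t) *\<^sub>R ?h y v + t\<^sup>2 *\<^sub>R ?h v v) +
       ?D (spray_coeff c ((snd c p, y) + t *\<^sub>R (0, v)))) has_vector_derivative
      2 *\<^sub>R ?h y v + ?D (fderiv (spray_coeff c) (snd c p, y) (0, v))) (at 0)"
    by (rule has_vector_derivative_add)
  with 1 show ?thesis by (rule vector_derivative_unique_at)
qed

lemma conn_coeff_transform:
  "conn_coeff d (snd d p, fderiv (transition c d) (snd c p) y) (fderiv (transition c d) (snd c p) v) =
    transition_hessian c d (snd c p) y v + fderiv (transition c d) (snd c p) (conn_coeff c (snd c p, y) v)"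
proof -
  let ?D = "fderiv (transition c d) (snd c p)" and ?h = "transition_hessian c d (snd c p)"
  note linD = linear_fderiv_transition[OF c d]
  have bD: "bounded_linear ?D"
    using transition_has_derivative[OF c d] has_derivative_bounded_linear by blast
  have at: "c \<in> atlas M" "snd c p \<in> snd c ` fst c" using c by (auto simp: charts_at_def)
  \<comment> \<open>By linearity, the transition derivative sends \<open>t *\<^sub>R y\<close> to
    \<open>t *\<^sub>R ?D y\<close>, so the integrals in both charts have the same
    parameter.\<close>
  have "fderiv (spray_coeff d) (snd d p, t *\<^sub>R ?D y) (0, ?D v) =
     (2 * t) *\<^sub>R ?h y v + ?D (fderiv (spray_coeff c) (snd c p, t *\<^sub>R y) (0, v))" for t
    using fderiv_spray_coeff_transform[of "t *\<^sub>R y" v] hessian_symmetric[of "t *\<^sub>R y" v] hessian_symmetric[of v y]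
    by (simp add: linear_cmul[OF linD] linear_cmul[OF hessian_linear])
  then have "conn_coeff d (snd d p, ?D y) (?D v) =
     integral {0..1} (\<lambda>t. (2 * t) *\<^sub>R ?h y v + ?D (fderiv (spray_coeff c) (snd c p, t *\<^sub>R y) (0, v)))"
    by (simp add: hadamard_def)
  also have "\<dots> = ?h y v + ?D (conn_coeff c (snd c p, y) v)"
  proof (rule integral_unique[OF has_integral_add[OF has_integral_linear_ramp]])
    have "((\<lambda>t. fderiv (spray_coeff c) (snd c p, t *\<^sub>R y) (0, v)) has_integral conn_coeff c (snd c p, y) v) {0..1}"
      using hadamard_integrable[OF open_chart_image[OF at(1)] smooth_spray_coeff[OF at(1)], of "(snd c p, y)" v] at(2)
      by (simp add: hadamard_def integrable_integral)
    from has_integral_linear[OF this bD]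
    show "((\<lambda>t. ?D (fderiv (spray_coeff c) (snd c p, t *\<^sub>R y) (0, v))) has_integral
       ?D (conn_coeff c (snd c p, y) v)) {0..1}" by (simp add: o_def)
  qed
  finally show ?thesis .
qed

end

section \<open>The horizontal bundle and its frames\<close>

definition horizontal :: "(('a, 'e) tvec, 'e \<times> 'e) tvec set" where
  "horizontal = {w \<in> tangent_vectors (tangent_bundle M). \<forall>c\<in>charts_at M (tproj (tproj w)).
     snd (snd w (tangent_chart M c)) =
       conn_coeff c (snd (tangent_chart M c) (tproj w)) (fst (snd w (tangent_chart M c)))}"

lemma linear_conn_coeff:
  assumes "c \<in> charts_at M p"
  shows "linear (conn_coeff c (snd c p, y))"
  using assms linear_hadamard[OF open_chart_image[of c] smooth_spray_coeff[of c], of "(snd c p, y)"]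
  by (auto simp: charts_at_def)

text \<open>The definition asks for the equation in every chart and so involves no choice. One chart
  suffices because \<open>conn_coeff\<close> acquires exactly the Hessian term that appears in the
  second component of a vector in \<open>TTM\<close>.\<close>

lemma horizontal_iff:
  assumes w: "w \<in> tangent_vectors (tangent_bundle M)" and c: "c \<in> charts_at M (tproj (tproj w))"
  shows "w \<in> horizontal \<longleftrightarrow> snd (snd w (tangent_chart M c)) =
      conn_coeff c (snd (tangent_chart M c) (tproj w)) (fst (snd w (tangent_chart M c)))"
proof
  let ?p = "tproj (tproj w)"
  have v: "tproj w \<in> tangent_vectors M" "w \<in> tangent_space (tangent_bundle M) (tproj w)"
    using w by (simp_all add: tangent_vectors_iff[of w])
  have vM: "tproj w \<in> tangent_space M ?p" using v(1) by (simp add: tangent_vectors_iff)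
  assume eq: "snd (snd w (tangent_chart M c)) =
      conn_coeff c (snd (tangent_chart M c) (tproj w)) (fst (snd w (tangent_chart M c)))"
  have "snd (snd w (tangent_chart M d)) =
      conn_coeff d (snd (tangent_chart M d) (tproj w)) (fst (snd w (tangent_chart M d)))"
    if d: "d \<in> charts_at M ?p" for d
  proof -
    obtain X where X: "snd w (tangent_chart M c) = (X, conn_coeff c (snd c ?p, snd (tproj w) c) X)"
      using eq by (metis prod.collapse tangent_chart_apply)
    have "snd w (tangent_chart M d) =
      fderiv (transition (tangent_chart M c) (tangent_chart M d)) (snd (tangent_chart M c) (tproj w))
         (snd w (tangent_chart M c))"
      by (intro T.tangent_component[OF v(2)] tangent_chart_in_charts_at v(1) c d)
    then have "snd w (tangent_chart M d) = (fderiv (transition c d) (snd c ?p) X,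
       transition_hessian c d (snd c ?p) (snd (tproj w) c) X +
       fderiv (transition c d) (snd c ?p) (conn_coeff c (snd c ?p, snd (tproj w) c) X))"
      by (simp add: X fderiv_transition_tangent_chart[OF c d])
    moreover have "snd (tproj w) d = fderiv (transition c d) (snd c ?p) (snd (tproj w) c)"
      by (rule tangent_component[OF vM c d])
    ultimately show ?thesis by (simp add: conn_coeff_transform[OF c d])
  qed
  then show "w \<in> horizontal" using w by (simp add: horizontal_def)
qed (use c in \<open>simp add: horizontal_def\<close>)

text \<open>The horizontal lift to \<open>v\<close> of the vector with components \<open>X\<close>
  in \<open>c\<close>. It parametrises the horizontal space as a graph over
  \<open>X\<close>.\<close>

definition lift :: "('a, 'e) chart \<Rightarrow> ('a, 'e) tvec \<Rightarrow> 'e \<Rightarrow> (('a, 'e) tvec, 'e \<times> 'e) tvec" where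
  "lift c v X = tvec_of (tangent_bundle M) (tangent_chart M c) v
     (X, conn_coeff c (snd (tangent_chart M c) v) X)"

lemma fibre_horizontal:
  assumes v: "v \<in> tangent_vectors M" and c: "c \<in> charts_at M (tproj v)"
  shows "fibre horizontal v = range (lift c v)"
proof
  note C = tangent_chart_in_charts_at[OF v c]
  show "range (lift c v) \<subseteq> fibre horizontal v"
    using T.tvec_of_in_tangent_vectors[OF C] c T.tvec_of_component[OF C]
    by (auto simp: fibre_def horizontal_iff lift_def)
  show "fibre horizontal v \<subseteq> range (lift c v)"
  proof
    fix w assume "w \<in> fibre horizontal v"
    then have w: "w \<in> horizontal" "tproj w = v" "w \<in> tangent_vectors (tangent_bundle M)"
      by (auto simp: fibre_def horizontal_def)
    have "tvec_of (tangent_bundle M) (tangent_chart M c) v (snd w (tangent_chart M c)) = w"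
      using w tangent_vectors_iff by (intro T.tvec_of_snd[OF _ C]) blast
    moreover have "snd w (tangent_chart M c) = (fst (snd w (tangent_chart M c)),
        conn_coeff c (snd (tangent_chart M c) v) (fst (snd w (tangent_chart M c))))"
      using w c horizontal_iff[OF w(3), of c] by (metis prod.collapse)
    ultimately have "w = lift c v (fst (snd w (tangent_chart M c)))" unfolding lift_def by simp
    then show "w \<in> range (lift c v)" by blast
  qed
qed

lemma smooth_lift:
  assumes "c \<in> atlas M"
  shows "smooth_vector_field_on (tangent_bundle M) (fst (tangent_chart M c)) (\<lambda>v. lift c v X)"
proof -
  have im: "snd (tangent_chart M c) ` fst (tangent_chart M c) = snd c ` fst c \<times> UNIV"
    using overlap_tangent_chart[OF assms assms] by simp
  have op: "open (snd c ` fst c \<times> (UNIV :: 'e set))"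
    using open_chart_image[OF assms] by (simp add: open_Times)
  have "smooth_on (snd c ` fst c \<times> UNIV) (\<lambda>z. (X, conn_coeff c z X))"
    by (intro smooth_on_Pair[OF op] smooth_on_const op
        smooth_on_hadamard[OF open_chart_image[OF assms] smooth_spray_coeff[OF assms] onb onb op smooth_on_ident])
      auto
  then show ?thesis
    unfolding lift_def using assms by (intro T.smooth_vector_field_chart) (auto simp only: im atlas_tangent_bundle)
qed

text \<open>\<open>lift\<close> is linear in \<open>X\<close>, so the lifts of the constant vectors
  of \<open>B\<close> form a frame over the whole domain of an induced chart, of rank
  \<open>card B\<close>.\<close>

lemma smooth_subbundle_horizontal: "smooth_subbundle (tangent_bundle M) horizontal"
  unfolding smooth_subbundle_def
proof (intro conjI ballI)
  show "horizontal \<subseteq> tangent_vectors (tangent_bundle M)" by (auto simp: horizontal_def)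
  fix v assume "v \<in> points (tangent_bundle M)"
  then obtain c where c: "c \<in> atlas M" "v \<in> fst (tangent_chart M c)"
    unfolding points_tangent_bundle using ex_tangent_chart by blast
  let ?k = "card B" and ?W = "fst (tangent_chart M c)"
  have finB: "finite B" using onb by (simp add: onb_def)
  then obtain b where b: "bij_betw b {0..<?k} B" using ex_bij_betw_nat_finite by blast
  then have b': "bij_betw b {..<?k} B" by (simp add: lessThan_atLeast0)
  have "fibre horizontal q = {tlincomb q ?k a (\<lambda>i. lift c q (b i)) |a. True} \<and>
     (\<forall>a. tlincomb q ?k a (\<lambda>i. lift c q (b i)) = tzero q \<longrightarrow> (\<forall>i<?k. a i = 0))" if q: "q \<in> ?W" for q
  proof (intro conjI allI impI)
    have qT: "q \<in> tangent_vectors M" and qc: "c \<in> charts_at M (tproj q)"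
      using q c by (simp_all add: mem_tangent_chart charts_at_def)
    note C = tangent_chart_in_charts_at[OF qT qc]
    have comb: "tlincomb q ?k a (\<lambda>i. lift c q (b i)) = lift c q (\<Sum>i<?k. a i *\<^sub>R b i)" for a
    proof -
      note lin = linear_conn_coeff[OF qc, of "snd q c"]
      have "(\<Sum>i<?k. a i *\<^sub>R (b i, conn_coeff c (snd (tangent_chart M c) q) (b i))) =
        (\<Sum>i<?k. a i *\<^sub>R b i, conn_coeff c (snd (tangent_chart M c) q) (\<Sum>i<?k. a i *\<^sub>R b i))"
        by (simp add: prod_eq_iff fst_sum snd_sum linear_sum[OF lin] linear_cmul[OF lin])
      then show ?thesis unfolding lift_def T.tlincomb_tvec_of[OF C] by simp
    qed
    have sum_b: "(\<Sum>i<?k. f (b i)) = sum f B" for f :: "'e \<Rightarrow> 'e"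
      by (rule sum.reindex_bij_betw[OF b'])
    show "fibre horizontal q = {tlincomb q ?k a (\<lambda>i. lift c q (b i)) |a. True}"
    proof -
      have "lift c q X \<in> {lift c q (\<Sum>i<?k. a i *\<^sub>R b i) |a. True}" for X
      proof -
        have "X = (\<Sum>i<?k. (X \<bullet> b i) *\<^sub>R b i)"
          using onb sum_b[of "\<lambda>b. (X \<bullet> b) *\<^sub>R b"] by (simp add: onb_def)
        then have "lift c q X = lift c q (\<Sum>i<?k. (X \<bullet> b i) *\<^sub>R b i)" by (rule arg_cong)
        then show ?thesis by (intro CollectI exI[of _ "\<lambda>i. X \<bullet> b i"] conjI TrueI)
      qed
      then show ?thesis unfolding fibre_horizontal[OF qT qc] comb by blast
    qed
    fix a i assume "tlincomb q ?k a (\<lambda>i. lift c q (b i)) = tzero q" and i: "i < ?k"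
    then have "snd (lift c q (\<Sum>i<?k. a i *\<^sub>R b i)) (tangent_chart M c) = 0"
      by (simp add: comb tzero_def)
    then have "(\<Sum>i<?k. a i *\<^sub>R b i) = 0"
      unfolding lift_def T.tvec_of_component[OF C] by (simp add: zero_prod_def)
    \<comment> \<open>The first components already give independence: pairing with
      \<open>b i\<close> isolates \<open>a i\<close>.\<close>
    then have "0 = (\<Sum>j<?k. a j *\<^sub>R b j) \<bullet> b i" by simp
    also have "\<dots> = (\<Sum>j<?k. a j * (b j \<bullet> b i))" by (simp add: inner_sum_left)
    also have "\<dots> = (\<Sum>j<?k. if j = i then a j else 0)"
    proof (rule sum.cong)
      fix j assume "j \<in> {..<?k}"
      then have "b j \<in> B" "b i \<in> B" "b j = b i \<longleftrightarrow> j = i"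
        using b' i by (auto simp: bij_betw_def inj_on_def)
      then show "a j * (b j \<bullet> b i) = (if j = i then a j else 0)"
        using onb by (simp add: onb_def)
    qed simp
    also have "\<dots> = a i" using i by simp
    finally show "a i = 0" by simp
  qed
  moreover have "openin (mtop (tangent_bundle M)) ?W"
    using c(1) by (intro T.openin_chart) simp
  ultimately show "\<exists>W k X. v \<in> W \<and> (\<forall>i<k. smooth_vector_field_on (tangent_bundle M) W (X i)) \<and>
        openin (mtop (tangent_bundle M)) W \<and>
        (\<forall>q\<in>W. fibre horizontal q = {tlincomb q k a (\<lambda>i. X i q) | a. True} \<and>
           (\<forall>a. tlincomb q k a (\<lambda>i. X i q) = tzero q \<longrightarrow> (\<forall>i<k. a i = 0)))"
    using c(2) smooth_lift[OF c(1)]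
    by (intro exI[of _ ?W] exI[of _ ?k] exI[of _ "\<lambda>i q. lift c q (b i)"]) blast
qed

text \<open>The first component transforms linearly, so its vanishing in one induced chart implies
  its vanishing in all of them.\<close>

lemma fibre_vertical:
  assumes v: "v \<in> tangent_vectors M" and c: "c \<in> charts_at M (tproj v)"
  shows "fibre (vertical_bundle M) v =
    range (\<lambda>Y. tvec_of (tangent_bundle M) (tangent_chart M c) v (0, Y))"
proof
  note C = tangent_chart_in_charts_at[OF v c]
  show "fibre (vertical_bundle M) v \<subseteq> range (\<lambda>Y. tvec_of (tangent_bundle M) (tangent_chart M c) v (0, Y))"
  proof
    fix w assume "w \<in> fibre (vertical_bundle M) v"
    then have w: "tproj w = v" "w \<in> tangent_vectors (tangent_bundle M)" "tproj_star M w = tzero (tproj v)"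
      by (auto simp: fibre_def vertical_bundle_def)
    have "fst (snd w (tangent_chart M c)) = snd (tproj_star M w) c"
      using c w(1,2) by (simp add: tproj_star_eq)
    then have "fst (snd w (tangent_chart M c)) = 0" unfolding w(3) by (simp add: tzero_def)
    then have "snd w (tangent_chart M c) = (0, snd (snd w (tangent_chart M c)))" by (metis prod.collapse)
    moreover have "tvec_of (tangent_bundle M) (tangent_chart M c) v (snd w (tangent_chart M c)) = w"
      using w tangent_vectors_iff by (intro T.tvec_of_snd[OF _ C]) blast
    ultimately show "w \<in> range (\<lambda>Y. tvec_of (tangent_bundle M) (tangent_chart M c) v (0, Y))"
      by (metis rangeI)
  qed
  have "tvec_of (tangent_bundle M) (tangent_chart M c) v (0, Y) \<in> fibre (vertical_bundle M) v" for Y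
  proof -
    let ?w = "tvec_of (tangent_bundle M) (tangent_chart M c) v (0, Y)"
    have w: "?w \<in> tangent_vectors (tangent_bundle M)" by (rule T.tvec_of_in_tangent_vectors[OF C])
    have "fst (snd ?w (tangent_chart M d)) = 0" if d: "d \<in> charts_at M (tproj v)" for d
      using fderiv_transition_tangent_chart[OF c d, of "snd v c" 0 Y] tangent_chart_in_charts_at[OF v d]
        linear_0[OF linear_fderiv_transition[OF c d]]
      by (simp add: tvec_of_def)
    then have "tproj_star M ?w = tzero (tproj v)"
      by (auto simp: tproj_star_eq[OF w] tzero_def)
    then show ?thesis using w by (simp add: fibre_def vertical_bundle_def)
  qed
  then show "range (\<lambda>Y. tvec_of (tangent_bundle M) (tangent_chart M c) v (0, Y)) \<subseteq> fibre (vertical_bundle M) v"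
    by blast
qed

text \<open>In one chart the horizontal space is a graph over the first factor and the vertical
  space is the second factor. A vector \<open>(X, Z)\<close> therefore splits only as
  \<open>(X, ?N X) + (0, Z - ?N X)\<close>.\<close>

lemma connection_horizontal: "connection M horizontal"
  unfolding connection_def
proof (intro conjI smooth_subbundle_horizontal ballI)
  fix w assume w: "w \<in> tangent_vectors (tangent_bundle M)"
  let ?v = "tproj w"
  have v: "?v \<in> tangent_vectors M" and wv: "w \<in> tangent_space (tangent_bundle M) ?v"
    using w by (simp_all add: tangent_vectors_iff[of w])
  obtain c where c: "c \<in> charts_at M (tproj ?v)" using v ex_chart tangent_vectors_iff by blast
  note C = tangent_chart_in_charts_at[OF v c]
  let ?V = "tvec_of (tangent_bundle M) (tangent_chart M c) ?v"
  let ?N = "conn_coeff c (snd (tangent_chart M c) ?v)"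
  have add: "w = tadd (lift c ?v X) (?V (0, Y)) \<longleftrightarrow>
      snd w (tangent_chart M c) = (X, ?N X + Y)" for X Y
  proof -
    have "tadd (lift c ?v X) (?V (0, Y)) = ?V (X, ?N X + Y)"
      unfolding lift_def T.tadd_tvec_of[OF C] by simp
    then show ?thesis using T.tvec_of_snd[OF wv C] T.tvec_of_component[OF C] by metis
  qed
  obtain X Z where XZ: "snd w (tangent_chart M c) = (X, Z)" by (cases "snd w (tangent_chart M c)")
  have eq_iff: "w = tadd (lift c ?v X') (?V (0, Y)) \<longleftrightarrow> X' = X \<and> Y = Z - ?N X" for X' Y
    unfolding add XZ by auto
  have "\<exists>!(h, u). h \<in> range (lift c ?v) \<and> u \<in> range (\<lambda>Y. ?V (0, Y)) \<and> w = tadd h u"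
  proof (rule ex1I[of _ "(lift c ?v X, ?V (0, Z - ?N X))"])
    show "case (lift c ?v X, ?V (0, Z - ?N X)) of (h, u) \<Rightarrow>
        h \<in> range (lift c ?v) \<and> u \<in> range (\<lambda>Y. ?V (0, Y)) \<and> w = tadd h u"
      unfolding prod.case using eq_iff by blast
    fix hu assume "case hu of (h, u) \<Rightarrow>
        h \<in> range (lift c ?v) \<and> u \<in> range (\<lambda>Y. ?V (0, Y)) \<and> w = tadd h u"
    then have hu: "fst hu \<in> range (lift c ?v)" "snd hu \<in> range (\<lambda>Y. ?V (0, Y))"
        "w = tadd (fst hu) (snd hu)"
      unfolding case_prod_beta by blast+
    obtain X' where X': "fst hu = lift c ?v X'" using hu(1) by blast
    obtain Y where Y: "snd hu = ?V (0, Y)" using hu(2) by blast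
    note w = hu(3)[unfolded X' Y]
    have "X' = X" "Y = Z - ?N X" using iffD1[OF eq_iff w] by blast+
    then show "hu = (lift c ?v X, ?V (0, Z - ?N X))" by (intro prod_eqI) (simp_all only: X' Y fst_conv snd_conv)
  qed
  then show "\<exists>!(h, u). h \<in> fibre horizontal (tproj w) \<and> u \<in> fibre (vertical_bundle M) (tproj w) \<and>
                  w = tadd h u"
    unfolding fibre_horizontal[OF v c] fibre_vertical[OF v c] .
qed

text \<open>\<open>S v\<close> is horizontal because \<open>conn_coeff\<close> applied to the fibre
  coordinate returns \<open>spray_coeff\<close>. As \<open>inv_into\<close> selects some preimage,
  injectivity on the horizontal space is also required to conclude that it selects
  \<open>S v\<close>.\<close>

lemma compatible_horizontal: "compatible M horizontal S"
  unfolding compatible_def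
proof
  fix v assume v: "v \<in> tangent_vectors M"
  obtain c where c: "c \<in> charts_at M (tproj v)" using v ex_chart tangent_vectors_iff by blast
  have at: "c \<in> atlas M" "tproj v \<in> fst c" using c by (simp_all add: charts_at_def)
  note C = tangent_chart_in_charts_at[OF v c]
  have "conn_coeff c (snd (tangent_chart M c) v) (snd v c) = spray_coeff c (snd (tangent_chart M c) v)"
    using hadamard_self[OF open_chart_image[OF at(1)] smooth_spray_coeff[OF at(1)], of "snd c (tproj v)" "snd v c"]
      at spray_coeff_zero[OF c] by simp
  then have S: "S v \<in> fibre horizontal v"
    using horizontal_iff[OF S_in_tangent_vectors[OF v], of c] c tproj_S[OF v] S_component[OF v c]
    by (simp add: fibre_def)
  have inj: "inj_on (tproj_star M) (fibre horizontal v)"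
  proof (rule inj_onI)
    fix w w' assume w: "w \<in> fibre horizontal v" and w': "w' \<in> fibre horizontal v"
      and eq: "tproj_star M w = tproj_star M w'"
    obtain X X' where X: "w = lift c v X" "w' = lift c v X'"
      using w w' unfolding fibre_horizontal[OF v c] by blast
    have "snd (tproj_star M (lift c v Y)) c = Y" for Y
    proof -
      have "lift c v Y \<in> tangent_vectors (tangent_bundle M)"
        unfolding lift_def by (rule T.tvec_of_in_tangent_vectors[OF C])
      then show ?thesis using c T.tvec_of_component[OF C] by (simp add: tproj_star_eq lift_def)
    qed
    then show "w = w'" using eq unfolding X by metis
  qed
  show "S v = inv_into (fibre horizontal v) (tproj_star M) v"
    using inv_into_f_f[OF inj S] tproj_star_S[OF v] by simp
qed

end

theorem theorem4p5:
  fixes M :: "('a, 'e::{real_inner, banach}) mfd"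
    and S :: "('a, 'e) tvec \<Rightarrow> (('a, 'e) tvec, 'e \<times> 'e) tvec"
  assumes "smooth_manifold M"
    and "quasispray M S"
  shows "\<exists>H. connection M H \<and> compatible M H S"
proof -
  obtain B :: "'e set" where "onb B"
    using assms(1) onb_exists unfolding smooth_manifold_def by blast
  then interpret quasispray_charts M B S
    using smooth_charts_manifold[OF assms(1)] assms(2)
    by (simp add: quasispray_charts_def quasispray_charts_axioms_def)
  show ?thesis using connection_horizontal compatible_horizontal by blast
qed

end
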